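(* Let $\psi:\Omega\times\mathbb R^+\to\mathbb R^+$ satisfy conditions (A1)--(A5) with exponents $1<p<q<\infty$, and let $\mathcal H(u,\Omega)=\int_\Omega\psi(x,|\nabla u(x)|)\,dx$. Suppose that for every $u\in W^{1,\psi}_0(\Omega)\cap L^\infty(\Omega)$ there exists a sequence $\{u^n\}_{n=1}^\infty\subset C_c^\infty(\Omega)$ such that $\|u^n-u\|_{1,\psi}\to0$ as $n\to\infty$. Then $C_c^\infty(\Omega)$ is dense in $W^{1,\psi}_0(\Omega)$ and the Lavrentiev phenomenon does not occur, i.e. for all $u_0\in W^{1,q}(\Omega)$ $$\inf_{u\in u_0+W^{1,p}_0(\Omega)}\mathcal H(u,\Omega)=\inf_{u\in u_0+W^{1,q}_0(\Omega)}\mathcal H(u,\Omega)=\inf_{u\in u_0+C_c^\infty(\Omega)}\mathcal H(u,\Omega).$$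
   Context: $\mathbb R^+=[0,\infty)$; $\Omega\subset\mathbb R^d$ is a bounded Lipschitz domain. The map $x\mapsto\psi(x,\xi)$ is measurable for each $\xi$. Conditions (for all $x\in\Omega$): (A1) $\psi(x,\xi)=0$ if and only if $\xi=0$; (A2) $\xi\mapsto\psi(x,\xi)$ is convex on $\mathbb R^+$; (A3) there is a strictly increasing continuous $m_\psi:\mathbb R^+\to\mathbb R^+$ with $m_\psi(0)=0$, $m_\psi(\xi)\le\psi(x,\xi)$ for all $\xi \geq 0$, and $m_\psi(\xi)/\xi\to\infty$ as $\xi\to\infty$; (A4) there are $\xi_0\ge1$ and constants $C_1,C_2>0$ such that $C_1\xi^p\le\psi(x,\xi)$ for $\xi\ge\xi_0$, and $\psi(x,\xi)\le C_2(1+\xi^q)$ for all $\xi\ge0$; (A5) there is a constant $C_4$ such that $\psi(x,2\xi)\le C_4\psi(x,\xi)$ for all $\xi\ge0$. Spaces: $\|f\|_\psi=\inf\{\lambda>0:\int_\Omega\psi(x,|f(x)|/\lambda)\,dx\le1\}$; $W^{1,\psi}(\Omega)=\{w\in W^{1,1}(\Omega):\|\nabla w\|_\psi<\infty\}$; $W^{1,\psi}_0(\Omega)=W^{1,1}_0(\Omega)\cap W^{1,\psi}(\Omega)$; norm $\|u\|_{1,\psi}=\|u\|_{L^1(\Omega)}+\|\nabla u\|_\psi$. *)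

theory Defs
  imports "HOL-Analysis.Analysis"
begin

text \<open>
  Functions on \<^term>\<open>\<Omega>\<close> are represented by total functions on the ambient Euclidean space;
  their values outside \<^term>\<open>\<Omega>\<close> never matter, and they are not identified when equal
  almost everywhere, so that the norms below are seminorms on functions.
\<close>

text \<open>Near each boundary point, \<^term>\<open>\<Omega>\<close> is the strict epigraph of a Lipschitz function of the
  coordinates orthogonal to some direction \<^term>\<open>e\<close>.\<close>

definition bounded_lipschitz_domain :: "'a::euclidean_space set \<Rightarrow> bool" where
  "bounded_lipschitz_domain \<Omega> \<longleftrightarrow>
     \<Omega> \<noteq> {} \<and> open \<Omega> \<and> connected \<Omega> \<and> bounded \<Omega> \<and>
     (\<forall>x\<in>frontier \<Omega>. \<exists>U e \<gamma> L. open U \<and> x \<in> U \<and> norm e = 1 \<and>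
        L-lipschitz_on UNIV (\<gamma> :: 'a \<Rightarrow> real) \<and>
        \<Omega> \<inter> U = {z \<in> U. \<gamma> (z - (z \<bullet> e) *\<^sub>R e) < z \<bullet> e})"

definition partial_deriv :: "'a::euclidean_space \<Rightarrow> ('a \<Rightarrow> real) \<Rightarrow> 'a \<Rightarrow> real" where
  "partial_deriv i f x = frechet_derivative f (at x) i"

primrec Ck :: "nat \<Rightarrow> ('a::euclidean_space \<Rightarrow> real) \<Rightarrow> bool" where
  "Ck 0 f \<longleftrightarrow> continuous_on UNIV f"
| "Ck (Suc k) f \<longleftrightarrow> (\<forall>x. f differentiable (at x)) \<and> (\<forall>i\<in>Basis. Ck k (partial_deriv i f))"

definition Cc_infty :: "'a::euclidean_space set \<Rightarrow> ('a \<Rightarrow> real) set" where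
  "Cc_infty \<Omega> = {\<phi>. (\<forall>k. Ck k \<phi>) \<and>
     compact (closure {x. \<phi> x \<noteq> 0}) \<and> closure {x. \<phi> x \<noteq> 0} \<subseteq> \<Omega>}"

definition Lp :: "'a::euclidean_space set \<Rightarrow> real \<Rightarrow> ('a \<Rightarrow> 'b::euclidean_space) set" where
  "Lp \<Omega> p = {f. f \<in> borel_measurable (lebesgue_on \<Omega>) \<and>
     integrable (lebesgue_on \<Omega>) (\<lambda>x. norm (f x) powr p)}"

text \<open>Only meaningful on \<^const>\<open>Lp\<close>: the Bochner integral of a non-integrable function is 0.\<close>

definition Lp_norm :: "'a::euclidean_space set \<Rightarrow> real \<Rightarrow> ('a \<Rightarrow> 'b::euclidean_space) \<Rightarrow> real" where
  "Lp_norm \<Omega> p f = (LINT x|lebesgue_on \<Omega>. norm (f x) powr p) powr (1 / p)"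

definition Linfty :: "'a::euclidean_space set \<Rightarrow> ('a \<Rightarrow> real) set" where
  "Linfty \<Omega> = {f. f \<in> borel_measurable (lebesgue_on \<Omega>) \<and>
     (\<exists>M. AE x in lebesgue_on \<Omega>. \<bar>f x\<bar> \<le> M)}"

definition is_weak_gradient ::
    "'a::euclidean_space set \<Rightarrow> ('a \<Rightarrow> real) \<Rightarrow> ('a \<Rightarrow> 'a) \<Rightarrow> bool" where
  "is_weak_gradient \<Omega> u g \<longleftrightarrow>
     (\<forall>K. compact K \<and> K \<subseteq> \<Omega> \<longrightarrow> integrable (lebesgue_on K) u \<and> integrable (lebesgue_on K) g) \<and>
     (\<forall>\<phi>\<in>Cc_infty \<Omega>. \<forall>i\<in>Basis.
        (LINT x|lebesgue_on \<Omega>. u x * partial_deriv i \<phi> x) =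
        - (LINT x|lebesgue_on \<Omega>. (g x \<bullet> i) * \<phi> x))"

text \<open>Weak gradients are unique only up to null sets; every use below is invariant under the
  choice of representative.\<close>

definition weak_grad :: "'a::euclidean_space set \<Rightarrow> ('a \<Rightarrow> real) \<Rightarrow> 'a \<Rightarrow> 'a" where
  "weak_grad \<Omega> u = (SOME g. is_weak_gradient \<Omega> u g)"

definition W1p :: "'a::euclidean_space set \<Rightarrow> real \<Rightarrow> ('a \<Rightarrow> real) set" where
  "W1p \<Omega> p = {u. u \<in> Lp \<Omega> p \<and> (\<exists>g. is_weak_gradient \<Omega> u g \<and> g \<in> Lp \<Omega> p)}"

definition W1p_norm :: "'a::euclidean_space set \<Rightarrow> real \<Rightarrow> ('a \<Rightarrow> real) \<Rightarrow> real" where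
  "W1p_norm \<Omega> p u = Lp_norm \<Omega> p u + Lp_norm \<Omega> p (weak_grad \<Omega> u)"

text \<open>The closure of \<^const>\<open>Cc_infty\<close> in \<^const>\<open>W1p\<close>.\<close>

definition W1p_0 :: "'a::euclidean_space set \<Rightarrow> real \<Rightarrow> ('a \<Rightarrow> real) set" where
  "W1p_0 \<Omega> p = {u \<in> W1p \<Omega> p.
     \<forall>\<epsilon>>0. \<exists>\<phi>\<in>Cc_infty \<Omega>. W1p_norm \<Omega> p (\<lambda>x. \<phi> x - u x) < \<epsilon>}"

text \<open>The Luxemburg norm takes values in \<open>[0, \<infinity>]\<close>, with infimum \<open>\<infinity>\<close> over the empty set.\<close>

definition psi_norm ::
    "'a::euclidean_space set \<Rightarrow> ('a \<Rightarrow> real \<Rightarrow> real) \<Rightarrow> ('a \<Rightarrow> 'b::real_normed_vector) \<Rightarrow> ennreal" where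
  "psi_norm \<Omega> \<psi> f =
     (INF c\<in>{c::real. c > 0 \<and> (\<integral>\<^sup>+x. ennreal (\<psi> x (norm (f x) / c)) \<partial>lebesgue_on \<Omega>) \<le> 1}. ennreal c)"

definition W1psi :: "'a::euclidean_space set \<Rightarrow> ('a \<Rightarrow> real \<Rightarrow> real) \<Rightarrow> ('a \<Rightarrow> real) set" where
  "W1psi \<Omega> \<psi> = {w \<in> W1p \<Omega> 1. psi_norm \<Omega> \<psi> (weak_grad \<Omega> w) < \<infinity>}"

definition W1psi_0 :: "'a::euclidean_space set \<Rightarrow> ('a \<Rightarrow> real \<Rightarrow> real) \<Rightarrow> ('a \<Rightarrow> real) set" where
  "W1psi_0 \<Omega> \<psi> = W1p_0 \<Omega> 1 \<inter> W1psi \<Omega> \<psi>"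

definition W1psi_norm ::
    "'a::euclidean_space set \<Rightarrow> ('a \<Rightarrow> real \<Rightarrow> real) \<Rightarrow> ('a \<Rightarrow> real) \<Rightarrow> ennreal" where
  "W1psi_norm \<Omega> \<psi> u =
     (\<integral>\<^sup>+x. ennreal \<bar>u x\<bar> \<partial>lebesgue_on \<Omega>) + psi_norm \<Omega> \<psi> (weak_grad \<Omega> u)"

definition dense_in_W1psi_0 ::
    "'a::euclidean_space set \<Rightarrow> ('a \<Rightarrow> real \<Rightarrow> real) \<Rightarrow> ('a \<Rightarrow> real) set \<Rightarrow> bool" where
  "dense_in_W1psi_0 \<Omega> \<psi> A \<longleftrightarrow> A \<subseteq> W1psi_0 \<Omega> \<psi> \<and>
     (\<forall>u\<in>W1psi_0 \<Omega> \<psi>. \<forall>\<epsilon>>0. \<exists>\<phi>\<in>A. W1psi_norm \<Omega> \<psi> (\<lambda>x. \<phi> x - u x) < \<epsilon>)"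

definition energy :: "'a::euclidean_space set \<Rightarrow> ('a \<Rightarrow> real \<Rightarrow> real) \<Rightarrow> ('a \<Rightarrow> real) \<Rightarrow> ennreal" where
  "energy \<Omega> \<psi> u = (\<integral>\<^sup>+x. ennreal (\<psi> x (norm (weak_grad \<Omega> u x))) \<partial>lebesgue_on \<Omega>)"

definition translate :: "('a \<Rightarrow> real) \<Rightarrow> ('a \<Rightarrow> real) set \<Rightarrow> ('a \<Rightarrow> real) set" where
  "translate u\<^sub>0 W = (\<lambda>w x. u\<^sub>0 x + w x) ` W"

end

theory Submission
  imports Defs
begin

text \<open>
  A function \<open>u\<close> of \<open>W\<^sub>0\<^sup>1\<^sup>,\<^sup>\<psi>\<close> is approximated by its bounded truncations \<open>T\<^sub>k u = k tanh (u / k)\<close>: since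
  \<open>\<nabla>T\<^sub>k u = (1 - tanh\<^sup>2 (u / k)) \<nabla>u\<close>, convexity, the doubling condition and dominated convergence give
  \<open>\<nabla>T\<^sub>k u \<rightarrow> \<nabla>u\<close> in the Luxemburg norm, and the hypothesis applies to \<open>T\<^sub>k u\<close>. A smooth truncation is
  used because it maps test functions to test functions, so that the chain rule and the zero boundary
  values of \<open>T\<^sub>k u\<close> follow by passing to the limit along test functions.

  For the energies, let \<open>w \<in> W\<^sub>0\<^sup>1\<^sup>,\<^sup>p\<close> be such that \<open>u\<^sub>0 + w\<close> has finite energy. The growth condition bounds the
  energy of \<open>u\<^sub>0\<close>, so \<open>w \<in> W\<^sub>0\<^sup>1\<^sup>,\<^sup>\<psi>\<close> by doubling. If \<open>e = \<nabla>\<phi> - \<nabla>w\<close> has Luxemburg norm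
  less than \<open>t\<close>, splitting \<open>|A| + |e| = (1 - 2 t) |A| + t (2 |A|) + t (|e| / t)\<close> with
  \<open>A = \<nabla>u\<^sub>0 + \<nabla>w\<close> and using convexity bounds the energy of \<open>u\<^sub>0 + \<phi>\<close> by
  \<open>(1 + t C)\<close> times that of \<open>u\<^sub>0 + w\<close>, plus \<open>t\<close>.
\<close>

subsection \<open>Smooth functions\<close>

text \<open>Enlarging a class can only lower its infimum, so the whole gap question is whether test
  functions do as well as W^{1,p}_0. Two obstacles shape the argument. A finite Luxemburg norm makes
  the modular finite at some scale only; doubling spreads this to all scales, and that is where the
  majorant for dominated convergence comes from. In the energy comparison, convexity with weights 1
  - t and t forces the argument |A| / (1 - t), slightly beyond |A|; being a convex combination of
  |A| and 2 |A|, it costs only a factor 1 + t C, with C the doubling constant. The other burden is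
  \<open>weak_grad\<close>, an arbitrary choice: computations replace it by an explicit gradient,
  which rests on uniqueness almost everywhere. The test functions for that are built from exp(-1/t)
  and tanh, and integration by parts for test functions comes from translation invariance of the
  integral.\<close>

lemma partial_deriv_eq: "(f has_derivative D) (at x) \<Longrightarrow> partial_deriv i f x = D i"
  unfolding partial_deriv_def by (metis frechet_derivative_at)

lemma differentiable_imp_has_derivative_partial:
  "f differentiable (at x) \<Longrightarrow> (f has_derivative (\<lambda>h. frechet_derivative f (at x) h)) (at x)"
  by (simp add: frechet_derivative_works[symmetric])

lemma Ck_continuous: "Ck k f \<Longrightarrow> continuous_on UNIV f"
  by (cases k)
    (auto simp: differentiable_imp_continuous_within continuous_on_eq_continuous_within)

text \<open>\<open>Ck (Suc k)\<close> constrains the first partial derivatives, so dropping one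
  order takes an induction through them, with continuity of differentiable functions at the
  bottom.\<close>

lemma Ck_Suc_imp: "Ck (Suc k) f \<Longrightarrow> Ck k f"
proof (induction k arbitrary: f)
  case 0
  then show ?case using Ck_continuous by (metis Ck.simps(1))
next
  case (Suc k)
  then show ?case by (metis Ck.simps(2))
qed

lemma partial_deriv_const [simp]: "partial_deriv i (\<lambda>x. c) = (\<lambda>x. 0)"
  by (rule ext, rule partial_deriv_eq[where D = "\<lambda>_. 0", simplified]) auto

lemma Ck_const [simp]: "Ck k (\<lambda>x. c)"
  by (induction k arbitrary: c) auto

lemma partial_deriv_add:
  assumes "f differentiable (at x)" "g differentiable (at x)"
  shows "partial_deriv i (\<lambda>x. f x + g x) x = partial_deriv i f x + partial_deriv i g x"
  using partial_deriv_eq[OF has_derivative_add[OF assms[THEN differentiable_imp_has_derivative_partial]]]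
  by (simp add: partial_deriv_def)

lemma partial_deriv_mult:
  assumes "f differentiable (at x)" "g differentiable (at x)"
  shows "partial_deriv i (\<lambda>x. f x * g x) x = f x * partial_deriv i g x + partial_deriv i f x * g x"
  using partial_deriv_eq[OF has_derivative_mult[OF assms[THEN differentiable_imp_has_derivative_partial]]]
  by (simp add: partial_deriv_def)

lemma partial_deriv_compose_real:
  assumes "f differentiable (at x)" "(F has_field_derivative D) (at (f x))"
  shows "partial_deriv i (\<lambda>x. F (f x)) x = D * partial_deriv i f x"
proof -
  have "((\<lambda>x. F (f x)) has_derivative (\<lambda>h. D * frechet_derivative f (at x) h)) (at x)"
    using has_derivative_compose[OF differentiable_imp_has_derivative_partial[OF assms(1)]
        assms(2)[unfolded has_field_derivative_def]]
    by simp
  from partial_deriv_eq[OF this] show ?thesis by (simp add: partial_deriv_def)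
qed

lemma Ck_add:
  assumes "Ck k f" "Ck k g"
  shows "Ck k (\<lambda>x. f x + g x)"
  using assms
proof (induction k arbitrary: f g)
  case 0
  then show ?case by (auto intro!: continuous_intros)
next
  case (Suc k)
  then have "partial_deriv i (\<lambda>x. f x + g x) = (\<lambda>x. partial_deriv i f x + partial_deriv i g x)" for i
    by (simp add: partial_deriv_add fun_eq_iff)
  with Suc.prems show ?case by (simp add: Suc.IH)
qed

lemma Ck_mult:
  assumes "Ck k f" "Ck k g"
  shows "Ck k (\<lambda>x. f x * g x)"
  using assms
proof (induction k arbitrary: f g)
  case 0
  then show ?case by (auto intro!: continuous_intros)
next
  case (Suc k)
  then have "partial_deriv i (\<lambda>x. f x * g x) =
      (\<lambda>x. f x * partial_deriv i g x + partial_deriv i f x * g x)" for i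
    by (simp add: partial_deriv_mult fun_eq_iff)
  with Suc.prems Suc.prems[THEN Ck_Suc_imp] show ?case by (simp add: Suc.IH Ck_add)
qed

lemma Ck_cmult: "Ck k f \<Longrightarrow> Ck k (\<lambda>x. c * f x)"
  by (intro Ck_mult Ck_const)

lemma Ck_diff: "Ck k f \<Longrightarrow> Ck k g \<Longrightarrow> Ck k (\<lambda>x. f x - g x)"
  using Ck_add[OF _ Ck_cmult[of k g "-1"]] by simp

lemma Ck_prod: "finite I \<Longrightarrow> (\<And>i. i \<in> I \<Longrightarrow> Ck k (f i)) \<Longrightarrow> Ck k (\<lambda>x. \<Prod>i\<in>I. f i x)"
  by (induction I rule: finite_induct) (auto intro!: Ck_mult)

lemma DERIV_tanh_real: "(tanh has_field_derivative 1 - tanh x ^ 2) (at (x::real))"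
  using has_field_derivative_tanh[of "\<lambda>x. x" x 1 UNIV] by simp

text \<open>The derivative factor 1 - tanh^2 is a polynomial in tanh itself, so the induction closes
  with products and differences of functions already known to be \<open>Ck k\<close>.\<close>

lemma Ck_tanh:
  assumes "Ck k f"
  shows "Ck k (\<lambda>x. tanh (f x))"
  using assms
proof (induction k arbitrary: f)
  case 0
  then show ?case by (auto intro!: continuous_intros)
next
  case (Suc k)
  then have "partial_deriv i (\<lambda>x. tanh (f x)) =
      (\<lambda>x. (1 - tanh (f x) * tanh (f x)) * partial_deriv i f x)" for i
    by (intro ext) (auto simp: power2_eq_square[symmetric]
        intro!: partial_deriv_compose_real DERIV_tanh_real)
  moreover have "(\<lambda>x. tanh (f x)) differentiable (at x)" for x
    unfolding differentiable_def
    by (rule exI, rule has_derivative_compose[OF differentiable_imp_has_derivative_partial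
          DERIV_tanh_real[unfolded has_field_derivative_def]])
      (use Suc.prems in simp)
  moreover have "Ck k (\<lambda>x. tanh (f x))"
    by (rule Suc.IH[OF Ck_Suc_imp[OF Suc.prems]])
  ultimately show ?case using Suc.prems
    by (simp add: Ck_mult Ck_diff)
qed

text \<open>The powers of \<open>t\<close> make the family closed under differentiation up to linear combinations.\<close>

definition flat :: "nat \<Rightarrow> real \<Rightarrow> real" where
  "flat n t = (if t > 0 then exp (- (1 / t)) / t ^ n else 0)"

text \<open>With s = 1 / t the claim is that s^n / exp s tends to 0 at infinity.\<close>

lemma flat_at_right: "(flat n \<longlongrightarrow> 0) (at_right 0)"
proof -
  have "((\<lambda>t. (1 / t) ^ n / exp (1 / t)) \<longlongrightarrow> 0) (at_right (0::real))"
    using filterlim_compose[OF tendsto_power_div_exp_0[of n] filterlim_inverse_at_top_right]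
    by (simp add: inverse_eq_divide)
  moreover have "eventually (\<lambda>t. (1 / t) ^ n / exp (1 / t) = flat n t) (at_right (0::real))"
    using eventually_at_right_less
    by (rule eventually_mono) (simp add: flat_def exp_minus field_simps)
  ultimately show ?thesis by (rule Lim_transform_eventually)
qed

lemma flat_at_left: "(flat n \<longlongrightarrow> 0) (at_left 0)"
  by (rule tendsto_eventually, rule eventually_at_leftI[of "-1"]) (auto simp: flat_def)

lemma flat_tendsto_0: "(flat n \<longlongrightarrow> 0) (at 0)"
  using flat_at_right flat_at_left by (simp add: filterlim_split_at)

text \<open>For t > 0 this is the quotient rule, for t < 0 both sides are 0. At 0 the difference
  quotient of \<open>flat n\<close> is \<open>flat (n + 1)\<close>, whose limit there is 0.\<close>

lemma DERIV_flat: "(flat n has_field_derivative flat (n + 2) t - real n * flat (n + 1) t) (at t)"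
proof -
  consider "t < 0" | "t = 0" | "t > 0" by linarith
  then show ?thesis
  proof cases
    case 1
    have "((\<lambda>_. 0) has_field_derivative 0) (at t)" by simp
    then have "(flat n has_field_derivative 0) (at t)"
      by (rule has_field_derivative_transform_within_open[of _ _ _ "{..<0}"])
        (use 1 in \<open>auto simp: flat_def\<close>)
    then show ?thesis using 1 by (simp add: flat_def)
  next
    case 2
    \<comment> \<open>At y = 0 the equality rests on division by zero being 0.\<close>
    have "flat (n + 1) = (\<lambda>y. (flat n y - flat n 0) / (y - 0))"
      by (auto simp: flat_def fun_eq_iff field_simps)
    with flat_tendsto_0[of "n+1"] show ?thesis using 2
      by (simp add: has_field_derivative_iff flat_def)
  next
    case 3
    have "((\<lambda>t. exp (- (1 / t)) / t ^ n) has_field_derivative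
        (exp (- (1 / t)) * (1 / t ^ 2) * t ^ n - exp (- (1 / t)) * (real n * t ^ (n - 1))) / (t ^ n * t ^ n)) (at t)"
      using 3 by (auto intro!: derivative_eq_intros simp: power2_eq_square)
    also have "(exp (- (1 / t)) * (1 / t ^ 2) * t ^ n - exp (- (1 / t)) * (real n * t ^ (n - 1))) / (t ^ n * t ^ n)
        = flat (n + 2) t - real n * flat (n + 1) t"
      \<comment> \<open>For n = 0 the exponent \<open>n - 1\<close> is truncated, and the factor
        \<open>real n\<close> removes that term.\<close>
      using 3 by (cases n) (auto simp: flat_def field_simps power_add power2_eq_square)
    finally have "((\<lambda>t. exp (- (1 / t)) / t ^ n) has_field_derivative
        flat (n + 2) t - real n * flat (n + 1) t) (at t)" .
    then show ?thesis
      by (rule has_field_derivative_transform_within_open[of _ _ _ "{0<..}"])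
        (use 3 in \<open>auto simp: flat_def\<close>)
  qed
qed

text \<open>The index n is left arbitrary in the induction because each differentiation raises it by
  1 and by 2.\<close>

lemma Ck_flat_affine: "Ck k (\<lambda>x::'a::euclidean_space. flat n (x \<bullet> v + c))"
proof (induction k arbitrary: n)
  case 0
  have "continuous_on UNIV (flat n)"
    by (auto simp: continuous_on_eq_continuous_at intro: DERIV_isCont[OF DERIV_flat])
  then show ?case
    by (auto intro!: continuous_on_compose2[of UNIV "flat n"] continuous_intros)
next
  case (Suc k)
  have D: "((\<lambda>x::'a. flat n (x \<bullet> v + c)) has_derivative
      (\<lambda>h. (flat (n + 2) (x \<bullet> v + c) - real n * flat (n + 1) (x \<bullet> v + c)) * (h \<bullet> v))) (at x)" for x
    by (rule has_derivative_compose[OF _ DERIV_flat[unfolded has_field_derivative_def]])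
      (auto intro!: derivative_eq_intros)
  have "partial_deriv i (\<lambda>x::'a. flat n (x \<bullet> v + c)) =
     (\<lambda>x. (flat (n + 2) (x \<bullet> v + c) - real n * flat (n + 1) (x \<bullet> v + c)) * (i \<bullet> v))" for i
    using partial_deriv_eq[OF D] by auto
  then show ?case using D
    by (auto simp: differentiable_def intro!: Ck_mult Ck_diff Ck_cmult Suc.IH)
qed

text \<open>These are the test functions behind the uniqueness of weak gradients. A product of
  \<open>flat\<close> factors, one per face of the box, is smooth, positive inside and 0 outside;
  applying tanh to n times this product keeps the values in [0, 1) and drives them to 1
  inside.\<close>

lemma smooth_functions_approximate_box:
  fixes a b :: "'a::euclidean_space"
  assumes "cbox a b \<subseteq> \<Omega>"
  obtains \<phi> where "\<And>n::nat. \<phi> n \<in> Cc_infty \<Omega>"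
    "\<And>n x. \<bar>\<phi> n x\<bar> \<le> indicator (cbox a b) x"
    "\<And>x. (\<lambda>n. \<phi> n x) \<longlonglongrightarrow> indicator (box a b) x"
proof -
  define B :: "'a \<Rightarrow> real" where
    "B x = (\<Prod>i\<in>Basis. flat 0 (x \<bullet> i + (- (a \<bullet> i))) * flat 0 (x \<bullet> (- i) + b \<bullet> i))" for x
  define \<phi> where "\<phi> n x = tanh (real n * B x)" for n x
  have B_pos: "B x > 0" if "x \<in> box a b" for x
    using that unfolding B_def by (intro prod_pos) (auto simp: flat_def mem_box)
  have B_0: "B x = 0" if "x \<notin> box a b" for x
    using that unfolding B_def mem_box by (auto simp: flat_def not_less) force
  have phi_0: "\<phi> n x = 0" if "x \<notin> box a b" for n x
    using B_0[OF that] by (simp add: \<phi>_def)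
  have closure: "closure {x. \<phi> n x \<noteq> 0} \<subseteq> cbox a b" for n
    by (rule closure_minimal) (use phi_0 box_subset_cbox[of a b] in \<open>auto\<close>)
  show ?thesis
  proof
    show "\<phi> n \<in> Cc_infty \<Omega>" for n
    proof -
      have "Ck k (\<phi> n)" for k
        unfolding \<phi>_def B_def by (intro Ck_tanh Ck_cmult Ck_prod Ck_mult Ck_flat_affine) auto
      moreover have "compact (closure {x. \<phi> n x \<noteq> 0})"
        using closure[of n] by (meson bounded_cbox bounded_subset closed_closure compact_eq_bounded_closed)
      ultimately show ?thesis using closure[of n] assms by (auto simp: Cc_infty_def)
    qed
    show "\<bar>\<phi> n x\<bar> \<le> indicator (cbox a b) x" for n x
      using phi_0[of x n] tanh_real_bounds[of "real n * B x"] box_subset_cbox[of a b]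
      by (auto simp: indicator_def \<phi>_def)
    show "(\<lambda>n. \<phi> n x) \<longlonglongrightarrow> indicator (box a b) x" for x
    proof (cases "x \<in> box a b")
      case True
      have "filterlim (\<lambda>n. real n * B x) at_top sequentially"
        using B_pos[OF True]
        by (intro filterlim_at_top_mult_tendsto_pos[OF tendsto_const _ filterlim_real_sequentially]) auto
      then show ?thesis using True filterlim_compose[OF tanh_real_at_top] by (simp add: \<phi>_def)
    qed (simp add: phi_0)
  qed
qed

subsection \<open>Test functions\<close>

text \<open>The classical gradient gives test functions an explicit weak gradient
  (\<open>is_weak_gradient_Cc_infty\<close>), in contrast to the choice made by
  \<open>weak_grad\<close>.\<close>

definition grad :: "('a::euclidean_space \<Rightarrow> real) \<Rightarrow> 'a \<Rightarrow> 'a" where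
  "grad f x = (\<Sum>i\<in>Basis. partial_deriv i f x *\<^sub>R i)"

lemma grad_inner: "i \<in> Basis \<Longrightarrow> grad f x \<bullet> i = partial_deriv i f x"
  by (simp add: grad_def)

lemma
  assumes "\<phi> \<in> Cc_infty \<Omega>"
  shows Cc_infty_differentiable: "\<phi> differentiable (at x)"
    and Cc_infty_continuous: "continuous_on UNIV \<phi>"
    and Cc_infty_continuous_partial: "i \<in> Basis \<Longrightarrow> continuous_on UNIV (partial_deriv i \<phi>)"
    and Cc_infty_continuous_grad: "continuous_on UNIV (grad \<phi>)"
proof -
  have "Ck (Suc 0) \<phi>" using assms by (auto simp: Cc_infty_def)
  then show "\<phi> differentiable (at x)" "continuous_on UNIV \<phi>"
    "i \<in> Basis \<Longrightarrow> continuous_on UNIV (partial_deriv i \<phi>)" "continuous_on UNIV (grad \<phi>)"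
    using Ck_continuous[of "Suc 0" \<phi>]
    by (auto simp: grad_def[abs_def] intro!: continuous_intros)
qed

text \<open>A single compact K serves the function and its first derivatives: the complement of the
  closed support is open, and the function is constantly 0 on it.\<close>

lemma Cc_infty_support:
  assumes "\<phi> \<in> Cc_infty \<Omega>"
  obtains K where "compact K" "K \<subseteq> \<Omega>" "\<And>x. x \<notin> K \<Longrightarrow> \<phi> x = 0"
    "\<And>i x. x \<notin> K \<Longrightarrow> partial_deriv i \<phi> x = 0" "\<And>x. x \<notin> K \<Longrightarrow> grad \<phi> x = 0"
proof -
  define K where "K = closure {x. \<phi> x \<noteq> 0}"
  have K: "compact K" "K \<subseteq> \<Omega>" using assms by (auto simp: Cc_infty_def K_def)
  have zero: "\<phi> x = 0" if "x \<notin> K" for x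
    unfolding K_def by (rule ccontr, drule closure_subset[THEN subsetD, OF CollectI], erule notE[OF that[unfolded K_def]])
  have "closed K" by (simp add: K_def)
  have partial: "partial_deriv i \<phi> x = 0" if "x \<notin> K" for i x
  proof -
    have "((\<lambda>_. 0) has_derivative (\<lambda>_. 0)) (at x)" by simp
    then have "(\<phi> has_derivative (\<lambda>_. 0)) (at x)"
      by (rule has_derivative_transform_within_open[of _ _ _ _ "- K"])
        (use that zero \<open>closed K\<close> in auto)
    then show ?thesis by (simp add: partial_deriv_eq)
  qed
  have "grad \<phi> x = 0" if "x \<notin> K" for x using partial[OF that] by (simp add: grad_def)
  with K zero partial show ?thesis by (rule that)
qed

lemma compact_support_bounded:
  fixes f :: "'a::euclidean_space \<Rightarrow> 'b::real_normed_vector"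
  assumes "continuous_on UNIV f" "compact K" "\<And>x. x \<notin> K \<Longrightarrow> f x = 0"
  obtains B where "B > 0" "\<And>x. norm (f x) \<le> B"
proof -
  have "bounded (f ` K)"
    using assms by (intro compact_imp_bounded compact_continuous_image) (auto intro: continuous_on_subset)
  then obtain B where "B > 0" "\<And>x. x \<in> K \<Longrightarrow> norm (f x) \<le> B"
    unfolding bounded_pos by auto
  with assms(3) that[of B] show ?thesis by (metis less_imp_le norm_zero)
qed

lemma Cc_infty_bounded:
  assumes "\<phi> \<in> Cc_infty \<Omega>"
  obtains B where "B > 0" "\<And>x. \<bar>\<phi> x\<bar> \<le> B" "\<And>x. norm (grad \<phi> x) \<le> B"
    "\<And>i x. i \<in> Basis \<Longrightarrow> \<bar>partial_deriv i \<phi> x\<bar> \<le> B"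
proof -
  obtain K where K: "compact K" "K \<subseteq> \<Omega>" "\<And>x. x \<notin> K \<Longrightarrow> \<phi> x = 0"
    "\<And>x. x \<notin> K \<Longrightarrow> grad \<phi> x = 0"
    using Cc_infty_support[OF assms] by metis
  obtain B1 where B1: "B1 > 0" "\<And>x. norm (\<phi> x) \<le> B1"
    using compact_support_bounded[OF Cc_infty_continuous[OF assms] K(1,3)] by metis
  obtain B2 where B2: "B2 > 0" "\<And>x. norm (grad \<phi> x) \<le> B2"
    using compact_support_bounded[OF Cc_infty_continuous_grad[OF assms] K(1,4)] by metis
  have "\<bar>partial_deriv i \<phi> x\<bar> \<le> B2" if "i \<in> Basis" for i x
    using Basis_le_norm[OF that, of "grad \<phi> x"] B2(2)[of x] by (simp add: grad_inner[OF that])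
  then show ?thesis using B1 B2
    by (intro that[of "max B1 B2"]) (auto simp: le_max_iff_disj)
qed

subsection \<open>Integration over an open set\<close>

lemma integrable_lebesgue_on_subset:
  fixes f :: "'a::euclidean_space \<Rightarrow> 'b::{banach, second_countable_topology}"
  assumes f: "integrable (lebesgue_on S) f" and "T \<subseteq> S" and S: "S \<in> sets lebesgue" and T: "T \<in> sets lebesgue"
  shows "integrable (lebesgue_on T) f"
proof -
  have "integrable lebesgue (\<lambda>x. indicator T x *\<^sub>R (indicator S x *\<^sub>R f x))"
    using f S T by (subst integrable_mult_indicator) (simp_all add: integrable_restrict_space)
  also have "(\<lambda>x. indicator T x *\<^sub>R (indicator S x *\<^sub>R f x)) = (\<lambda>x. indicator T x *\<^sub>R f x)"
    using \<open>T \<subseteq> S\<close> by (auto simp: indicator_def fun_eq_iff)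
  finally show ?thesis using T by (simp add: integrable_restrict_space)
qed

lemma borel_measurable_lebesgue_continuous:
  fixes f :: "'a::euclidean_space \<Rightarrow> 'b::{second_countable_topology, topological_space}"
  shows "continuous_on UNIV f \<Longrightarrow> f \<in> borel_measurable lebesgue"
  by (intro measurable_completion) (simp add: borel_measurable_continuous_onI)

lemma borel_measurable_lebesgue_on_continuous:
  fixes f :: "'a::euclidean_space \<Rightarrow> 'b::{second_countable_topology, topological_space}"
  shows "continuous_on UNIV f \<Longrightarrow> f \<in> borel_measurable (lebesgue_on S)"
  by (intro measurable_restrict_space1 borel_measurable_lebesgue_continuous)

text \<open>Functions with a weak gradient, and the gradient itself, are integrable only over
  compact subsets. A factor supported in K turns integrability over K into integrability over the
  whole domain.\<close>

lemma integrable_mult_compact_support: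
  fixes u :: "'a::euclidean_space \<Rightarrow> 'b::{banach, second_countable_topology}"
  assumes \<Omega>: "\<Omega> \<in> sets lebesgue" and K: "compact K" "K \<subseteq> \<Omega>"
    and u: "integrable (lebesgue_on K) u"
    and f: "continuous_on UNIV (f :: 'a \<Rightarrow> real)" "\<And>x. x \<notin> K \<Longrightarrow> f x = 0"
  shows "integrable (lebesgue_on \<Omega>) (\<lambda>x. f x *\<^sub>R u x)"
proof -
  obtain B where B: "B > 0" "\<And>x. \<bar>f x\<bar> \<le> B"
    using compact_support_bounded[OF f(1) K(1) f(2)] by (metis real_norm_def)
  have [measurable]: "K \<in> sets lebesgue" using K(1) by (simp add: fmeasurableD lmeasurable_compact)
  have u': "integrable lebesgue (\<lambda>x. indicator K x *\<^sub>R u x)"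
    using u by (simp add: integrable_restrict_space)
  have [measurable]: "f \<in> borel_measurable lebesgue"
    by (rule borel_measurable_lebesgue_continuous[OF f(1)])
  have "integrable lebesgue (\<lambda>x. f x *\<^sub>R (indicator K x *\<^sub>R u x))"
  proof (rule Bochner_Integration.integrable_bound)
    show "integrable lebesgue (\<lambda>x. B *\<^sub>R (indicator K x *\<^sub>R u x))"
      using u' by (rule integrable_scaleR_right)
    show "(\<lambda>x. f x *\<^sub>R (indicator K x *\<^sub>R u x)) \<in> borel_measurable lebesgue"
      using u' borel_measurable_integrable by measurable
    show "AE x in lebesgue. norm (f x *\<^sub>R (indicator K x *\<^sub>R u x)) \<le> norm (B *\<^sub>R (indicator K x *\<^sub>R u x))"
      using B by (intro AE_I2) (auto simp: abs_mult intro!: mult_right_mono)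
  qed
  also have "(\<lambda>x. f x *\<^sub>R (indicator K x *\<^sub>R u x)) = (\<lambda>x. indicator \<Omega> x *\<^sub>R (f x *\<^sub>R u x))"
    using K f(2) by (auto simp: indicator_def fun_eq_iff)
  finally show ?thesis using \<Omega> by (simp add: integrable_restrict_space)
qed

text \<open>Dynkin argument: open boxes are stable under intersection and generate the Borel sets,
  so the integral vanishes over every Borel set, then over every Lebesgue set, and
  \<open>density_zero\<close> concludes.\<close>

lemma AE_zero_if_box_integrals_zero:
  fixes f :: "'a::euclidean_space \<Rightarrow> real"
  assumes f: "integrable lebesgue f"
    and boxes: "\<And>c d. (LINT x:box c d|lebesgue. f x) = 0"
  shows "AE x in lebesgue. f x = 0"
proof -
  have set_int: "set_integrable lebesgue A f" if "A \<in> sets lebesgue" for A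
    unfolding set_integrable_def using that f by (rule integrable_mult_indicator)
  \<comment> \<open>The whole space, exhausted by growing boxes, is what the complement case of the
    induction below consumes.\<close>
  have "(LINT x:UNIV|lebesgue. f x) = 0"
  proof -
    have "(\<lambda>n::nat. LINT x:box (- real n *\<^sub>R One) (real n *\<^sub>R One)|lebesgue. f x) \<longlonglongrightarrow>
        (LINT x:(\<Union>n::nat. box (- real n *\<^sub>R One) (real n *\<^sub>R One))|lebesgue. f x)"
    proof (rule set_integral_cont_up)
      show "incseq (\<lambda>n::nat. box (- real n *\<^sub>R One) (real n *\<^sub>R (One::'a)))"
        by (force simp: incseq_def mem_box)
    qed (auto intro!: set_int)
    then show ?thesis by (simp add: boxes UN_box_eq_UNIV LIMSEQ_const_iff)
  qed
  then have total: "integral\<^sup>L lebesgue f = 0" by (simp add: set_lebesgue_integral_def)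
  have borel: "(LINT x:A|lebesgue. f x) = 0" if "A \<in> sets borel" for A
  proof -
    let ?G = "range (\<lambda>(a, b). box a b :: 'a set)"
    have "Int_stable ?G" by (auto simp: Int_stable_def box_Int_box)
    moreover have "?G \<subseteq> Pow UNIV" by simp
    moreover have "A \<in> sigma_sets UNIV ?G" using that by (simp add: borel_eq_box)
    ultimately show ?thesis
    proof (induction rule: sigma_sets_induct_disjoint)
      case (basic A)
      then show ?case by (auto simp: boxes)
    next
      case empty
      then show ?case by (simp add: set_lebesgue_integral_def)
    next
      case (compl A)
      have "A \<in> sets borel" using compl(1) by (simp add: borel_eq_box)
      then have A: "A \<in> sets lebesgue" by simp
      have "(LINT x:A \<union> (UNIV - A)|lebesgue. f x) =
          (LINT x:A|lebesgue. f x) + (LINT x:UNIV - A|lebesgue. f x)"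
        using A by (intro set_integral_Un set_int) auto
      then show ?case using compl(2) total by (simp add: set_lebesgue_integral_def)
    next
      case (union A)
      have "A i \<in> sets borel" for i using union(2) by (auto simp: borel_eq_box)
      then have A: "A i \<in> sets lebesgue" for i by simp
      have "(LINT x:(\<Union>i. A i)|lebesgue. f x) = (\<Sum>i. LINT x:A i|lebesgue. f x)"
        using A union(1) by (intro lebesgue_integral_countable_add set_int) (auto simp: disjoint_family_on_def)
      then show ?case using union(3) by simp
    qed
  qed
  have lebesgue: "(LINT x:A|lebesgue. f x) = 0" if "A \<in> sets lebesgue" for A
  proof -
    \<comment> \<open>A Lebesgue set differs from a Borel set only inside a Borel null set.\<close>
    obtain S N N' where A: "A = S \<union> N" "N \<subseteq> N'" "N' \<in> null_sets lborel" "S \<in> sets lborel"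
      using \<open>A \<in> sets lebesgue\<close> by (rule sets_completionE)
    have "AE x in lebesgue. x \<notin> N'"
      using A(3) by (intro AE_not_in null_sets_completionI)
    then have "AE x in lebesgue. indicator A x *\<^sub>R f x = indicator S x *\<^sub>R f x"
      by (rule eventually_mono) (use A(1,2) in \<open>auto simp: indicator_def\<close>)
    moreover have "S \<in> sets lebesgue" using A by simp
    ultimately have "(LINT x:A|lebesgue. f x) = (LINT x:S|lebesgue. f x)"
      unfolding set_lebesgue_integral_def using that f
      by (intro integral_cong_AE borel_measurable_integrable integrable_mult_indicator)
    with borel A(4) show ?thesis by simp
  qed
  interpret sigma_finite_measure "lebesgue :: 'a measure"
  proof
    show "\<exists>A::'a set set. countable A \<and> A \<subseteq> sets lebesgue \<and> \<Union> A = space lebesgue \<and>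
        (\<forall>a\<in>A. emeasure lebesgue a \<noteq> \<infinity>)"
    proof (intro exI conjI ballI)
      let ?A = "range (\<lambda>n::nat. box (- real n *\<^sub>R One) (real n *\<^sub>R (One::'a)))"
      show "countable ?A" "?A \<subseteq> sets lebesgue" by auto
      show "\<Union> ?A = space lebesgue" using UN_box_eq_UNIV by auto
      show "emeasure lebesgue a \<noteq> \<infinity>" if "a \<in> ?A" for a
        using that by (auto simp: emeasure_lborel_box_eq)
    qed
  qed
  show ?thesis using f lebesgue by (rule density_zero)
qed

text \<open>By translation invariance every difference quotient of h in direction i has integral 0.
  The quotients converge to the partial derivative and, by the mean value theorem, are dominated by
  a bound for it on a fixed ball.\<close>

lemma integral_partial_deriv_eq_0:
  fixes h :: "'a::euclidean_space \<Rightarrow> real"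
  assumes h: "Ck (Suc 0) h" and K: "compact K" "\<And>x. x \<notin> K \<Longrightarrow> h x = 0"
    "\<And>x. x \<notin> K \<Longrightarrow> partial_deriv i h x = 0" and i: "i \<in> Basis"
  shows "integrable lborel (partial_deriv i h)" "integral\<^sup>L lborel (partial_deriv i h) = 0"
proof -
  have cont: "continuous_on UNIV h" "continuous_on UNIV (partial_deriv i h)"
    and diff: "\<And>x. h differentiable (at x)"
    using h i Ck_continuous[OF h] by auto
  have [measurable]: "h \<in> borel_measurable borel" "partial_deriv i h \<in> borel_measurable borel"
    using cont by (auto intro: borel_measurable_continuous_onI)
  obtain B where B: "B > 0" "\<And>x. \<bar>partial_deriv i h x\<bar> \<le> B"
    using compact_support_bounded[OF cont(2) K(1,3)] by (metis real_norm_def)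
  obtain R where R: "\<And>x. x \<in> K \<Longrightarrow> norm x \<le> R"
    using compact_imp_bounded[OF K(1)] by (auto simp: bounded_iff)
  have int: "integrable lborel f" if "continuous_on UNIV f" "\<And>x. x \<notin> K \<Longrightarrow> f x = 0" for f :: "'a \<Rightarrow> real"
  proof -
    have "integrable lborel (\<lambda>x. indicator K x *\<^sub>R f x)"
      using that K(1) by (intro borel_integrable_compact) (auto intro: continuous_on_subset)
    also have "(\<lambda>x. indicator K x *\<^sub>R f x) = f" using that by (auto simp: indicator_def fun_eq_iff)
    finally show ?thesis .
  qed
  show "integrable lborel (partial_deriv i h)" using cont(2) K(3) by (rule int)
  have deriv: "((\<lambda>t. h (x + t *\<^sub>R i)) has_field_derivative partial_deriv i h (x + t *\<^sub>R i)) (at t)" for x t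
  proof -
    have 1: "((\<lambda>t. x + t *\<^sub>R i) has_derivative (\<lambda>s. s *\<^sub>R i)) (at t)"
      by (auto intro!: derivative_eq_intros)
    interpret D: linear "frechet_derivative h (at (x + t *\<^sub>R i))"
      using linear_frechet_derivative[OF diff] .
    have "((\<lambda>t. h (x + t *\<^sub>R i)) has_derivative
        (\<lambda>s. frechet_derivative h (at (x + t *\<^sub>R i)) (s *\<^sub>R i))) (at t)"
      by (rule has_derivative_compose[OF 1 differentiable_imp_has_derivative_partial[OF diff]])
    also have "(\<lambda>s. frechet_derivative h (at (x + t *\<^sub>R i)) (s *\<^sub>R i)) =
        (*) (partial_deriv i h (x + t *\<^sub>R i))"
      by (simp add: partial_deriv_def D.scale fun_eq_iff)
    finally show ?thesis by (simp add: has_field_derivative_def)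
  qed
  define t where "t n = inverse (real (Suc n))" for n
  have t: "0 < t n" "t n \<le> 1" for n by (auto simp: t_def field_simps)
  have t0: "filterlim t (at 0) sequentially"
    using LIMSEQ_inverse_real_of_nat t(1) unfolding filterlim_at t_def by (auto intro!: always_eventually)
  define s where "s n x = (h (x + t n *\<^sub>R i) - h x) / t n" for n x
  have lim: "(\<lambda>n. s n x) \<longlonglongrightarrow> partial_deriv i h x" for x
    using filterlim_compose[OF deriv[of x 0, unfolded has_field_derivative_iff] t0]
    by (simp add: s_def)
  \<comment> \<open>The increments are at most 1, so outside the ball of radius R + 1 neither x nor
    its translate lies in K.\<close>
  have bound: "norm (s n x) \<le> B * indicator (cball 0 (R + 1)) x" for n x
  proof (cases "norm x \<le> R + 1")
    case True
    obtain z where "0 < z" "z < t n"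
      "h (x + t n *\<^sub>R i) - h (x + 0 *\<^sub>R i) = (t n - 0) * partial_deriv i h (x + z *\<^sub>R i)"
      using MVT2[of 0 "t n" "\<lambda>t. h (x + t *\<^sub>R i)" "\<lambda>z. partial_deriv i h (x + z *\<^sub>R i)"] t(1) deriv
      by blast
    then have "s n x = partial_deriv i h (x + z *\<^sub>R i)" using t(1)[of n] by (simp add: s_def)
    with B True show ?thesis by (simp add: indicator_def)
  next
    case False
    have "norm x \<le> norm (x + t n *\<^sub>R i) + norm (t n *\<^sub>R i)"
      using norm_triangle_ineq4[of "x + t n *\<^sub>R i" "t n *\<^sub>R i"] by simp
    then have "norm x \<le> norm (x + t n *\<^sub>R i) + 1" using t[of n] i by simp
    then have "x \<notin> K" "x + t n *\<^sub>R i \<notin> K" using R False by force+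
    then show ?thesis using K(2) B(1) by (simp add: s_def)
  qed
  have s0: "integral\<^sup>L lborel (s n) = 0" for n
  proof -
    have eq: "(\<lambda>x. h (x + t n *\<^sub>R i)) = (\<lambda>x. h ((+) (t n *\<^sub>R i) x))" by (simp add: add.commute)
    have "integrable lborel (\<lambda>x. h (x + t n *\<^sub>R i))"
      unfolding eq by (rule integrable_distr[of "(+) (t n *\<^sub>R i)" lborel borel h])
        (auto simp: lborel_distr_plus int[OF cont(1) K(2)])
    moreover have "integral\<^sup>L lborel (\<lambda>x. h (x + t n *\<^sub>R i)) = integral\<^sup>L lborel h"
      unfolding eq by (subst integral_distr[symmetric, of "(+) (t n *\<^sub>R i)" lborel borel h]) (auto simp: lborel_distr_plus)
    ultimately show ?thesis using int[OF cont(1) K(2)] by (simp add: s_def[abs_def])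
  qed
  have "(\<lambda>n. integral\<^sup>L lborel (s n)) \<longlonglongrightarrow> integral\<^sup>L lborel (partial_deriv i h)"
  proof (rule integral_dominated_convergence[where w = "\<lambda>x. B * indicator (cball 0 (R + 1)) x"])
    show "integrable lborel (\<lambda>x::'a. B * indicator (cball 0 (R + 1)) x :: real)"
      using emeasure_bounded_finite[of "cball (0::'a) (R + 1)"]
      by (intro integrable_mult_right integrable_real_indicator) simp_all
    show "s n \<in> borel_measurable lborel" for n unfolding s_def by measurable
  qed (use lim bound in auto)
  then show "integral\<^sup>L lborel (partial_deriv i h) = 0" by (simp add: s0 LIMSEQ_const_iff)
qed

subsection \<open>Weak gradients\<close>

text \<open>Integration by parts: the partial derivative of the product with another test function
  has integral 0 by \<open>integral_partial_deriv_eq_0\<close>, and the product rule splits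
  it.\<close>

lemma is_weak_gradient_Cc_infty:
  fixes \<Omega> :: "'a::euclidean_space set"
  assumes \<Omega>: "open \<Omega>" and \<phi>: "\<phi> \<in> Cc_infty \<Omega>"
  shows "is_weak_gradient \<Omega> \<phi> (grad \<phi>)"
  unfolding is_weak_gradient_def
proof (intro conjI allI impI ballI)
  fix K :: "'a set" assume K: "compact K \<and> K \<subseteq> \<Omega>"
  have 1: "integrable (lebesgue_on K) f" if "continuous_on UNIV f" for f :: "'a \<Rightarrow> 'b::euclidean_space"
  proof -
    have "integrable lborel (\<lambda>x. indicator K x *\<^sub>R f x)"
      using that K by (intro borel_integrable_compact) (auto intro: continuous_on_subset)
    moreover have "K \<in> sets lebesgue" "K \<in> sets borel"
      using K by (auto simp add: fmeasurableD lmeasurable_compact borel_compact)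
    ultimately show ?thesis
      using that by (simp add: integrable_restrict_space integrable_completion borel_measurable_continuous_onI)
  qed
  show "integrable (lebesgue_on K) \<phi>" "integrable (lebesgue_on K) (grad \<phi>)"
    by (auto intro!: 1 Cc_infty_continuous[OF \<phi>] Cc_infty_continuous_grad[OF \<phi>])
next
  fix \<eta> :: "'a \<Rightarrow> real" and i :: 'a assume \<eta>: "\<eta> \<in> Cc_infty \<Omega>" and i: "i \<in> Basis"
  obtain K where K: "compact K" "K \<subseteq> \<Omega>" "\<And>x. x \<notin> K \<Longrightarrow> \<phi> x = 0"
    "\<And>x. x \<notin> K \<Longrightarrow> partial_deriv i \<phi> x = 0"
    using Cc_infty_support[OF \<phi>] by metis
  have \<Omega>': "\<Omega> \<in> sets lebesgue" "\<Omega> \<in> sets borel" using \<Omega> by auto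
  have Kl: "K \<in> sets lebesgue" using K by (auto simp add: fmeasurableD lmeasurable_compact)
  note cont = Cc_infty_continuous[OF \<phi>] Cc_infty_continuous[OF \<eta>]
    Cc_infty_continuous_partial[OF \<phi> i] Cc_infty_continuous_partial[OF \<eta> i]
  have Ck: "Ck (Suc 0) (\<lambda>x. \<phi> x * \<eta> x)"
    using \<phi> \<eta> by (intro Ck_mult) (auto simp only: Cc_infty_def mem_Collect_eq)
  have pd: "partial_deriv i (\<lambda>x. \<phi> x * \<eta> x) x = \<phi> x * partial_deriv i \<eta> x + partial_deriv i \<phi> x * \<eta> x" for x
    by (intro partial_deriv_mult Cc_infty_differentiable[OF \<phi>] Cc_infty_differentiable[OF \<eta>])
  have zero: "integral\<^sup>L lborel (partial_deriv i (\<lambda>x. \<phi> x * \<eta> x)) = 0"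
    by (rule integral_partial_deriv_eq_0(2)[OF Ck K(1) _ _ i]) (auto simp: K pd)
  have int: "integrable (lebesgue_on \<Omega>) (\<lambda>x. f x *\<^sub>R g x)"
    if "continuous_on UNIV f" "continuous_on UNIV g" "\<And>x. x \<notin> K \<Longrightarrow> f x = 0" for f g :: "'a \<Rightarrow> real"
  proof (rule integrable_mult_compact_support[OF \<Omega>'(1) K(1,2) _ that(1,3)])
    have "integrable lborel (\<lambda>x. indicator K x *\<^sub>R g x)"
      using that K by (intro borel_integrable_compact) (auto intro: continuous_on_subset)
    then show "integrable (lebesgue_on K) g"
      using that Kl K(1) by (simp add: integrable_restrict_space integrable_completion
          borel_measurable_continuous_onI borel_compact)
  qed
  have "(LINT x|lebesgue_on \<Omega>. \<phi> x * partial_deriv i \<eta> x) + (LINT x|lebesgue_on \<Omega>. partial_deriv i \<phi> x * \<eta> x)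
      = (LINT x|lebesgue_on \<Omega>. partial_deriv i (\<lambda>x. \<phi> x * \<eta> x) x)"
    using int[OF cont(1,4) K(3)] int[OF cont(3,2) K(4)] by (simp add: pd)
  also have "\<dots> = (LINT x|lebesgue. indicator \<Omega> x *\<^sub>R partial_deriv i (\<lambda>x. \<phi> x * \<eta> x) x)"
    using \<Omega>' by (simp add: integral_restrict_space)
  \<comment> \<open>The product and its derivative vanish outside K, a subset of the domain, so the
    integral may be taken over the whole space.\<close>
  also have "(\<lambda>x. indicator \<Omega> x *\<^sub>R partial_deriv i (\<lambda>x. \<phi> x * \<eta> x) x) = partial_deriv i (\<lambda>x. \<phi> x * \<eta> x)"
    using K(2) K(3,4)[OF contra_subsetD[OF K(2)]] by (auto simp: pd indicator_def fun_eq_iff)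
  also have "(LINT x|lebesgue. partial_deriv i (\<lambda>x. \<phi> x * \<eta> x) x) = 0"
  proof -
    have "partial_deriv i (\<lambda>x. \<phi> x * \<eta> x) \<in> borel_measurable lborel"
      using Ck i Ck_continuous by (auto intro!: borel_measurable_continuous_onI)
    then show ?thesis using zero by (simp add: integral_completion)
  qed
  finally show "(LINT x|lebesgue_on \<Omega>. \<phi> x * partial_deriv i \<eta> x) =
      - (LINT x|lebesgue_on \<Omega>. (grad \<phi> x \<bullet> i) * \<eta> x)"
    using i by (simp add: grad_inner)
qed

text \<open>The Bochner integral of a non-integrable function is 0, so adding or subtracting
  instances of the defining identity requires integrability on both of its sides.\<close>

lemma weak_gradient_test_integrable:
  fixes \<Omega> :: "'a::euclidean_space set"
  assumes \<Omega>: "open \<Omega>" and g: "is_weak_gradient \<Omega> u g" and \<phi>: "\<phi> \<in> Cc_infty \<Omega>" and i: "i \<in> Basis"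
  shows "integrable (lebesgue_on \<Omega>) (\<lambda>x. u x * partial_deriv i \<phi> x)"
    and "integrable (lebesgue_on \<Omega>) (\<lambda>x. (g x \<bullet> i) * \<phi> x)"
proof -
  obtain K where K: "compact K" "K \<subseteq> \<Omega>" "\<And>x. x \<notin> K \<Longrightarrow> \<phi> x = 0"
    "\<And>x. x \<notin> K \<Longrightarrow> partial_deriv i \<phi> x = 0"
    using Cc_infty_support[OF \<phi>] by metis
  have u: "integrable (lebesgue_on K) u" "integrable (lebesgue_on K) (\<lambda>x. g x \<bullet> i)"
    using g K by (auto simp: is_weak_gradient_def)
  have \<Omega>': "\<Omega> \<in> sets lebesgue" using \<Omega> by auto
  show "integrable (lebesgue_on \<Omega>) (\<lambda>x. u x * partial_deriv i \<phi> x)"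
    using integrable_mult_compact_support[OF \<Omega>' K(1,2) u(1) Cc_infty_continuous_partial[OF \<phi> i] K(4)]
    by (simp add: mult.commute)
  show "integrable (lebesgue_on \<Omega>) (\<lambda>x. (g x \<bullet> i) * \<phi> x)"
    using integrable_mult_compact_support[OF \<Omega>' K(1,2) u(2) Cc_infty_continuous[OF \<phi>] K(3)]
    by (simp add: mult.commute)
qed

lemma is_weak_gradient_add:
  fixes \<Omega> :: "'a::euclidean_space set"
  assumes "open \<Omega>" "is_weak_gradient \<Omega> u g" "is_weak_gradient \<Omega> v h"
  shows "is_weak_gradient \<Omega> (\<lambda>x. u x + v x) (\<lambda>x. g x + h x)"
  unfolding is_weak_gradient_def
proof (intro conjI ballI)
  fix \<phi> and i :: 'a assume t: "\<phi> \<in> Cc_infty \<Omega>" "i \<in> Basis"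
  note int = weak_gradient_test_integrable[OF assms(1,2) t] weak_gradient_test_integrable[OF assms(1,3) t]
  show "(LINT x|lebesgue_on \<Omega>. (u x + v x) * partial_deriv i \<phi> x) =
        - (LINT x|lebesgue_on \<Omega>. (g x + h x) \<bullet> i * \<phi> x)"
    using int assms(2,3) t by (simp add: is_weak_gradient_def distrib_right inner_add_left)
qed (use assms in \<open>auto simp: is_weak_gradient_def\<close>)

lemma is_weak_gradient_diff:
  fixes \<Omega> :: "'a::euclidean_space set"
  assumes "open \<Omega>" "is_weak_gradient \<Omega> u g" "is_weak_gradient \<Omega> v h"
  shows "is_weak_gradient \<Omega> (\<lambda>x. u x - v x) (\<lambda>x. g x - h x)"
  unfolding is_weak_gradient_def
proof (intro conjI ballI)
  fix \<phi> and i :: 'a assume t: "\<phi> \<in> Cc_infty \<Omega>" "i \<in> Basis"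
  note int = weak_gradient_test_integrable[OF assms(1,2) t] weak_gradient_test_integrable[OF assms(1,3) t]
  show "(LINT x|lebesgue_on \<Omega>. (u x - v x) * partial_deriv i \<phi> x) =
        - (LINT x|lebesgue_on \<Omega>. (g x - h x) \<bullet> i * \<phi> x)"
    using int assms(2,3) t by (simp add: is_weak_gradient_def left_diff_distrib inner_diff_left)
qed (use assms in \<open>auto simp: is_weak_gradient_def\<close>)

text \<open>Local integrability gives measurability on compact subsets; a countable cover by closed
  boxes glues these pieces.\<close>

lemma weak_gradient_measurable:
  fixes \<Omega> :: "'a::euclidean_space set"
  assumes \<Omega>: "open \<Omega>" and g: "is_weak_gradient \<Omega> u g"
  shows "u \<in> borel_measurable (lebesgue_on \<Omega>)" and "g \<in> borel_measurable (lebesgue_on \<Omega>)"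
proof -
  obtain \<D> where \<D>: "countable \<D>" "\<D> \<subseteq> Pow \<Omega>" "\<And>X. X \<in> \<D> \<Longrightarrow> \<exists>a b. X = cbox a b" "\<Union>\<D> = \<Omega>"
    using open_countable_Union_open_cbox[OF \<Omega>] by metis
  have \<Omega>': "\<Omega> \<in> sets lebesgue" using \<Omega> by auto
  have cb: "compact X" "X \<subseteq> \<Omega>" "X \<in> sets lebesgue" if "X \<in> \<D>" for X
    using \<D>(2) \<D>(3)[OF that] that by auto
  have restr: "restrict_space (lebesgue_on \<Omega>) X = lebesgue_on X" if "X \<in> \<D>" for X
    using cb[OF that] \<Omega>' by (simp add: restrict_restrict_space Int_absorb1)
  have "X \<inter> space (lebesgue_on \<Omega>) \<in> sets (lebesgue_on \<Omega>)" if "X \<in> \<D>" for X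
    using cb(2,3)[OF that] \<Omega>' by (simp add: sets_restrict_space_iff Int_absorb2)
  note piecewise = measurable_piecewise_restrict[OF \<D>(1) this]
  have int: "integrable (lebesgue_on X) u" "integrable (lebesgue_on X) g" if "X \<in> \<D>" for X
    using g cb(1,2)[OF that] unfolding is_weak_gradient_def by blast+
  show "u \<in> borel_measurable (lebesgue_on \<Omega>)"
  proof (rule piecewise)
    show "u \<in> borel_measurable (restrict_space (lebesgue_on \<Omega>) X)" if "X \<in> \<D>" for X
      unfolding restr[OF that] by (rule borel_measurable_integrable[OF int(1)[OF that]])
  qed (use \<D>(4) in auto)
  show "g \<in> borel_measurable (lebesgue_on \<Omega>)"
  proof (rule piecewise)
    show "g \<in> borel_measurable (restrict_space (lebesgue_on \<Omega>) X)" if "X \<in> \<D>" for X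
      unfolding restr[OF that] by (rule borel_measurable_integrable[OF int(2)[OF that]])
  qed (use \<D>(4) in auto)
qed

text \<open>The fundamental lemma of the calculus of variations. Testing with smooth approximations
  of box indicators shows that the components of the difference integrate to 0 over every open box
  whose closed box lies in the domain. A countable cover by closed boxes then allows
  \<open>AE_zero_if_box_integrals_zero\<close> to be applied on each piece.\<close>

lemma weak_gradient_unique:
  fixes \<Omega> :: "'a::euclidean_space set"
  assumes \<Omega>: "open \<Omega>" and g: "is_weak_gradient \<Omega> u g" and h: "is_weak_gradient \<Omega> u h"
  shows "AE x in lebesgue_on \<Omega>. g x = h x"
proof -
  have \<Omega>': "\<Omega> \<in> sets lebesgue" using \<Omega> by auto
  obtain \<D> where \<D>: "countable \<D>" "\<D> \<subseteq> Pow \<Omega>" "\<And>X. X \<in> \<D> \<Longrightarrow> \<exists>a b. X = cbox a b" "\<Union>\<D> = \<Omega>"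
    using open_countable_Union_open_cbox[OF \<Omega>] by metis
  have test: "(LINT x|lebesgue_on \<Omega>. ((g x - h x) \<bullet> i) * \<phi> x) = 0"
    if "\<phi> \<in> Cc_infty \<Omega>" "i \<in> Basis" for \<phi> i
    using is_weak_gradient_diff[OF \<Omega> g h] that by (simp add: is_weak_gradient_def)
  have box: "(LINT x:box a b|lebesgue. (g x - h x) \<bullet> i) = 0"
    if ab: "cbox a b \<subseteq> \<Omega>" and i: "i \<in> Basis" for a b i
  proof -
    obtain \<phi> where \<phi>: "\<And>n::nat. \<phi> n \<in> Cc_infty \<Omega>"
      "\<And>n x. \<bar>\<phi> n x\<bar> \<le> indicator (cbox a b) x"
      "\<And>x. (\<lambda>n. \<phi> n x) \<longlonglongrightarrow> indicator (box a b) x"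
      using smooth_functions_approximate_box[OF ab] by metis
    let ?d = "\<lambda>x. (g x - h x) \<bullet> i"
    have int: "integrable lebesgue (\<lambda>x. indicator (cbox a b) x *\<^sub>R ?d x)"
    proof -
      have "integrable (lebesgue_on (cbox a b)) ?d"
        using g h ab by (auto simp: is_weak_gradient_def inner_diff_left)
      then show ?thesis by (simp add: integrable_restrict_space)
    qed
    have "(\<lambda>n. LINT x|lebesgue_on \<Omega>. ?d x * \<phi> n x) \<longlonglongrightarrow> (LINT x|lebesgue_on \<Omega>. ?d x * indicator (box a b) x)"
    \<comment> \<open>The difference need not be integrable over the whole domain; the bound on the
      test functions confines the majorant to one closed box.\<close>
    proof (rule integral_dominated_convergence[where w = "\<lambda>x. \<bar>indicator (cbox a b) x *\<^sub>R ?d x\<bar>"])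
      have "integrable (lebesgue_on \<Omega>) (\<lambda>x. indicator (cbox a b) x *\<^sub>R ?d x)"
        using int integrable_lebesgue_on_subset[of UNIV _ \<Omega>] \<Omega>' by (simp add: lebesgue_on_UNIV_eq)
      then show "integrable (lebesgue_on \<Omega>) (\<lambda>x. \<bar>indicator (cbox a b) x *\<^sub>R ?d x\<bar>)"
        by (rule integrable_abs)
      have [measurable]: "?d \<in> borel_measurable (lebesgue_on \<Omega>)"
        using weak_gradient_measurable[OF \<Omega> g] weak_gradient_measurable[OF \<Omega> h] by measurable
      have [measurable]: "\<phi> n \<in> borel_measurable (lebesgue_on \<Omega>)" for n
        by (intro borel_measurable_lebesgue_on_continuous Cc_infty_continuous[OF \<phi>(1)])
      have "indicator (box a b) \<in> borel_measurable lebesgue" by (rule borel_measurable_indicator) simp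
      then have [measurable]: "(indicator (box a b) :: 'a \<Rightarrow> real) \<in> borel_measurable (lebesgue_on \<Omega>)"
        by (rule measurable_restrict_space1)
      show "(\<lambda>x. ?d x * indicator (box a b) x) \<in> borel_measurable (lebesgue_on \<Omega>)"
        "\<And>n. (\<lambda>x. ?d x * \<phi> n x) \<in> borel_measurable (lebesgue_on \<Omega>)" by measurable
      show "AE x in lebesgue_on \<Omega>. (\<lambda>n. ?d x * \<phi> n x) \<longlonglongrightarrow> ?d x * indicator (box a b) x"
        by (intro AE_I2 tendsto_intros \<phi>)
      show "AE x in lebesgue_on \<Omega>. norm (?d x * \<phi> n x) \<le> \<bar>indicator (cbox a b) x *\<^sub>R ?d x\<bar>" for n
      proof (rule AE_I2)
        fix x
        have "\<bar>?d x\<bar> * \<bar>\<phi> n x\<bar> \<le> \<bar>?d x\<bar> * indicator (cbox a b) x"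
          by (rule mult_left_mono[OF \<phi>(2)]) simp
        then show "norm (?d x * \<phi> n x) \<le> \<bar>indicator (cbox a b) x *\<^sub>R ?d x\<bar>"
          by (simp add: abs_mult mult.commute)
      qed
    qed
    then have "(LINT x|lebesgue_on \<Omega>. ?d x * indicator (box a b) x) = 0"
      by (simp add: test[OF \<phi>(1) i] LIMSEQ_const_iff)
    moreover have "(\<lambda>x. indicator \<Omega> x *\<^sub>R (?d x * indicator (box a b) x)) = (\<lambda>x. indicator (box a b) x *\<^sub>R ?d x)"
      using ab box_subset_cbox[of a b] by (auto simp: indicator_def fun_eq_iff)
    ultimately show ?thesis
      using \<Omega>' by (simp add: integral_restrict_space set_lebesgue_integral_def)
  qed
  have "AE x in lebesgue. x \<in> X \<longrightarrow> (g x - h x) \<bullet> i = 0" if X: "X \<in> \<D>" and i: "i \<in> Basis" for X i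
  proof -
    obtain a b where X_eq: "X = cbox a b" using \<D>(3)[OF X] by auto
    have ab: "cbox a b \<subseteq> \<Omega>" using \<D>(2) X X_eq by auto
    let ?f = "\<lambda>x. indicator (cbox a b) x *\<^sub>R ((g x - h x) \<bullet> i)"
    have "AE x in lebesgue. ?f x = 0"
    proof (rule AE_zero_if_box_integrals_zero)
      have "integrable (lebesgue_on (cbox a b)) (\<lambda>x. (g x - h x) \<bullet> i)"
        using g h ab by (auto simp: is_weak_gradient_def inner_diff_left)
      then show "integrable lebesgue ?f" by (simp add: integrable_restrict_space)
      then have meas: "?f \<in> borel_measurable lebesgue" by (rule borel_measurable_integrable)
      fix c d
      \<comment> \<open>The difference, cut off to \<open>cbox a b\<close>, is to be integrated over
        an arbitrary box. The intersection of that box with \<open>box a b\<close> is again a box,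
        to which the fact \<open>box\<close> applies, and the boundary of \<open>cbox a b\<close> is
        a null set.\<close>
      obtain a' b' where ab': "box a b \<inter> box c d = box a' b'" "cbox a b \<inter> cbox c d = cbox a' b'"
        using box_Int_box[of a b c d] Int_interval[of a b c d] by blast
      have null: "AE x in lebesgue. x \<notin> cbox a b - box a b"
        using negligible_frontier_interval by (intro AE_not_in) (simp add: negligible_iff_null_sets)
      have *: "indicator (box c d) x *\<^sub>R ?f x = indicator (box a' b') x *\<^sub>R ((g x - h x) \<bullet> i)"
        if "x \<notin> cbox a b - box a b" for x
        using that box_subset_cbox[of a b] unfolding ab'(1)[symmetric] by (auto simp: indicator_def)
      have "(LINT x:box c d|lebesgue. ?f x) = (LINT x:box a' b'|lebesgue. (g x - h x) \<bullet> i)"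
        unfolding set_lebesgue_integral_def
      proof (rule integral_cong_AE)
        have ind: "(indicator (box r s) :: 'a \<Rightarrow> real) \<in> borel_measurable lebesgue" for r s
          by (rule borel_measurable_indicator) simp
        show "(\<lambda>x. indicator (box c d) x *\<^sub>R ?f x) \<in> borel_measurable lebesgue"
          by (rule borel_measurable_scaleR[OF ind meas])
        have "(\<lambda>x. indicator (box a' b') x *\<^sub>R ((g x - h x) \<bullet> i)) =
            (\<lambda>x. indicator (box a' b') x *\<^sub>R ?f x)"
          using ab' box_subset_cbox[of a b] by (auto simp: indicator_def fun_eq_iff)
        then show "(\<lambda>x. indicator (box a' b') x *\<^sub>R ((g x - h x) \<bullet> i)) \<in> borel_measurable lebesgue"
          using borel_measurable_scaleR[OF ind meas] by (simp only:)
        show "AE x in lebesgue. indicator (box c d) x *\<^sub>R ?f x =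
            indicator (box a' b') x *\<^sub>R ((g x - h x) \<bullet> i)"
          using null by (rule eventually_mono) (rule *)
      qed
      also have "\<dots> = 0" using ab ab' by (intro box[OF _ i]) auto
      finally show "(LINT x:box c d|lebesgue. ?f x) = 0" .
    qed
    then show ?thesis unfolding X_eq by (rule eventually_mono) (auto simp: indicator_def)
  qed
  then have "AE x in lebesgue. \<forall>X\<in>\<D>. \<forall>i\<in>Basis. x \<in> X \<longrightarrow> (g x - h x) \<bullet> i = 0"
    using \<D>(1) by (intro AE_ball_countable[THEN iffD2] ballI countable_finite[OF finite_Basis]) auto
  then have "AE x in lebesgue. x \<in> \<Omega> \<longrightarrow> g x = h x"
    by (rule eventually_mono) (use \<D>(4) in \<open>auto simp: euclidean_eq_iff[where 'a='a] inner_diff_left\<close>)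
  then show ?thesis using \<Omega>' by (simp add: AE_restrict_space_iff)
qed

text \<open>\<open>SOME\<close> picks a genuine weak gradient as soon as one exists; uniqueness then
  lets any explicit gradient stand in for it almost everywhere.\<close>

lemma weak_grad:
  assumes "open \<Omega>" "is_weak_gradient \<Omega> u g"
  shows "is_weak_gradient \<Omega> u (weak_grad \<Omega> u)" and "AE x in lebesgue_on \<Omega>. weak_grad \<Omega> u x = g x"
proof -
  show "is_weak_gradient \<Omega> u (weak_grad \<Omega> u)"
    unfolding weak_grad_def using assms(2) by (rule someI[of "is_weak_gradient \<Omega> u"])
  from weak_gradient_unique[OF assms(1) this assms(2)]
  show "AE x in lebesgue_on \<Omega>. weak_grad \<Omega> u x = g x" .
qed

text \<open>A test function and its partial derivatives are bounded, so both integrals in the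
  defining identity are continuous under L1 convergence.\<close>

lemma is_weak_gradient_L1_limit:
  fixes \<Omega> :: "'a::euclidean_space set"
  assumes \<Omega>: "open \<Omega>" and vG: "\<And>n. is_weak_gradient \<Omega> (v n) (G n)"
    and v: "\<And>n. integrable (lebesgue_on \<Omega>) (v n)" "integrable (lebesgue_on \<Omega>) v'"
      "(\<lambda>n. LINT x|lebesgue_on \<Omega>. norm (v n x - v' x)) \<longlonglongrightarrow> 0"
    and G: "\<And>n. integrable (lebesgue_on \<Omega>) (G n)" "integrable (lebesgue_on \<Omega>) G'"
      "(\<lambda>n. LINT x|lebesgue_on \<Omega>. norm (G n x - G' x)) \<longlonglongrightarrow> 0"
  shows "is_weak_gradient \<Omega> v' G'"
  unfolding is_weak_gradient_def
proof (intro conjI allI impI ballI)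
  have \<Omega>': "\<Omega> \<in> sets lebesgue" using \<Omega> by auto
  show "integrable (lebesgue_on K) v'" "integrable (lebesgue_on K) G'" if "compact K \<and> K \<subseteq> \<Omega>" for K
    using that integrable_lebesgue_on_subset[OF v(2) _ \<Omega>', of K]
      integrable_lebesgue_on_subset[OF G(2) _ \<Omega>', of K]
    by (auto simp: fmeasurableD lmeasurable_compact)
  fix \<phi> :: "'a \<Rightarrow> real" and i :: 'a assume \<phi>: "\<phi> \<in> Cc_infty \<Omega>" and i: "i \<in> Basis"
  obtain B where B: "B > 0" "\<And>x. \<bar>\<phi> x\<bar> \<le> B" "\<And>x. \<bar>partial_deriv i \<phi> x\<bar> \<le> B"
    using Cc_infty_bounded[OF \<phi>] i by metis
  \<comment> \<open>Used twice: for \<open>v\<close> against the partial derivative of the test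
    function, and for the component of \<open>G\<close> along i against the test function
    itself.\<close>
  have *: "(\<lambda>n. LINT x|lebesgue_on \<Omega>. w n x * \<eta> x) \<longlonglongrightarrow> (LINT x|lebesgue_on \<Omega>. w' x * \<eta> x)"
    if w: "\<And>n. integrable (lebesgue_on \<Omega>) (w n)" "integrable (lebesgue_on \<Omega>) w'"
      "(\<lambda>n. LINT x|lebesgue_on \<Omega>. norm (w n x - w' x)) \<longlonglongrightarrow> 0"
      and \<eta>: "continuous_on UNIV \<eta>" "\<And>x. \<bar>\<eta> x\<bar> \<le> B" for w :: "nat \<Rightarrow> 'a \<Rightarrow> real" and w' \<eta> :: "'a \<Rightarrow> real"
  proof -
    have [measurable]: "\<eta> \<in> borel_measurable (lebesgue_on \<Omega>)"
      by (rule borel_measurable_lebesgue_on_continuous[OF \<eta>(1)])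
    have bound: "\<bar>a * \<eta> x\<bar> \<le> B * \<bar>a\<bar>" for a x
      using mult_left_mono[OF \<eta>(2)[of x], of "\<bar>a\<bar>"] by (simp add: abs_mult mult.commute)
    have int: "integrable (lebesgue_on \<Omega>) (\<lambda>x. f x * \<eta> x)"
      if "integrable (lebesgue_on \<Omega>) f" for f :: "_ \<Rightarrow> real"
    proof (rule Bochner_Integration.integrable_bound)
      show "integrable (lebesgue_on \<Omega>) (\<lambda>x. B * f x)" using that by simp
      show "AE x in lebesgue_on \<Omega>. norm (f x * \<eta> x) \<le> norm (B * f x)"
        using bound B(1) by (intro AE_I2) (simp add: abs_mult)
    qed (use that in measurable)
    have "norm ((LINT x|lebesgue_on \<Omega>. w n x * \<eta> x) - (LINT x|lebesgue_on \<Omega>. w' x * \<eta> x))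
       \<le> B * (LINT x|lebesgue_on \<Omega>. norm (w n x - w' x))" for n
    proof -
      have "(LINT x|lebesgue_on \<Omega>. w n x * \<eta> x) - (LINT x|lebesgue_on \<Omega>. w' x * \<eta> x) =
          (LINT x|lebesgue_on \<Omega>. (w n x - w' x) * \<eta> x)"
        using int w by (simp add: left_diff_distrib)
      also have "norm \<dots> \<le> (LINT x|lebesgue_on \<Omega>. B * norm (w n x - w' x))"
      proof (rule Bochner_Integration.integral_norm_bound_integral)
        show "norm ((w n x - w' x) * \<eta> x) \<le> B * norm (w n x - w' x)" for x
          using bound[of "w n x - w' x" x] by simp
      qed (intro int Bochner_Integration.integrable_diff integrable_mult_right integrable_norm w(1,2))+
      finally show ?thesis by simp
    qed
    moreover have "(\<lambda>n. B * (LINT x|lebesgue_on \<Omega>. norm (w n x - w' x))) \<longlonglongrightarrow> 0"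
      using tendsto_mult_left[OF w(3), of B] by simp
    ultimately have "(\<lambda>n. (LINT x|lebesgue_on \<Omega>. w n x * \<eta> x) - (LINT x|lebesgue_on \<Omega>. w' x * \<eta> x)) \<longlonglongrightarrow> 0"
      by (rule Lim_null_comparison[OF always_eventually[OF allI]])
    then show ?thesis by (rule LIM_zero_cancel)
  qed
  have vlim: "(\<lambda>n. LINT x|lebesgue_on \<Omega>. v n x * partial_deriv i \<phi> x) \<longlonglongrightarrow>
      (LINT x|lebesgue_on \<Omega>. v' x * partial_deriv i \<phi> x)"
    using v by (rule *[OF _ _ _ Cc_infty_continuous_partial[OF \<phi> i] B(3)])
  have Glim: "(\<lambda>n. LINT x|lebesgue_on \<Omega>. (G n x \<bullet> i) * \<phi> x) \<longlonglongrightarrow>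
      (LINT x|lebesgue_on \<Omega>. (G' x \<bullet> i) * \<phi> x)"
  proof (rule *[OF _ _ _ Cc_infty_continuous[OF \<phi>] B(2)])
    show "integrable (lebesgue_on \<Omega>) (\<lambda>x. G n x \<bullet> i)" "integrable (lebesgue_on \<Omega>) (\<lambda>x. G' x \<bullet> i)" for n
      using G by auto
    have "(LINT x|lebesgue_on \<Omega>. norm (G n x \<bullet> i - G' x \<bullet> i)) \<le> (LINT x|lebesgue_on \<Omega>. norm (G n x - G' x))" for n
    proof (rule integral_mono)
      show "norm (G n x \<bullet> i - G' x \<bullet> i) \<le> norm (G n x - G' x)" for x
        using Basis_le_norm[OF i, of "G n x - G' x"] by (simp add: inner_diff_left)
    qed (intro integrable_norm Bochner_Integration.integrable_diff integrable_inner_left G(1,2))+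
    then have "norm (LINT x|lebesgue_on \<Omega>. norm (G n x \<bullet> i - G' x \<bullet> i)) \<le>
        (LINT x|lebesgue_on \<Omega>. norm (G n x - G' x))" for n
      by (subst real_norm_def, subst abs_of_nonneg) simp_all
    then show "(\<lambda>n. LINT x|lebesgue_on \<Omega>. norm (G n x \<bullet> i - G' x \<bullet> i)) \<longlonglongrightarrow> 0"
      by (rule Lim_null_comparison[OF always_eventually[OF allI] G(3)])
  qed
  from tendsto_minus[OF Glim] have "(\<lambda>n. - (LINT x|lebesgue_on \<Omega>. (G n x \<bullet> i) * \<phi> x)) \<longlonglongrightarrow>
      - (LINT x|lebesgue_on \<Omega>. (G' x \<bullet> i) * \<phi> x)"
    .
  moreover have "(LINT x|lebesgue_on \<Omega>. v n x * partial_deriv i \<phi> x) = - (LINT x|lebesgue_on \<Omega>. (G n x \<bullet> i) * \<phi> x)" for n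
    using vG[of n, unfolded is_weak_gradient_def, THEN conjunct2, THEN bspec, OF \<phi>, THEN bspec, OF i] .
  ultimately show "(LINT x|lebesgue_on \<Omega>. v' x * partial_deriv i \<phi> x) = - (LINT x|lebesgue_on \<Omega>. (G' x \<bullet> i) * \<phi> x)"
    by (intro LIMSEQ_unique[OF vlim]) simp
qed

subsection \<open>Sobolev spaces\<close>

lemma Lp_norm_nonneg: "0 \<le> Lp_norm \<Omega> p f"
  by (simp add: Lp_norm_def)

lemma integral_norm_nonneg: "0 \<le> (LINT x|M. norm (f x))"
  by (simp add: integral_nonneg_AE)

lemma Lp_norm_1: "Lp_norm \<Omega> 1 f = (LINT x|lebesgue_on \<Omega>. norm (f x))"
  by (simp add: Lp_norm_def integral_nonneg_AE)

lemma Lp_1_iff: "f \<in> Lp \<Omega> 1 \<longleftrightarrow> integrable (lebesgue_on \<Omega>) f"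
  by (auto simp: Lp_def integrable_norm_iff)

lemma Lp_cong_AE:
  assumes "f \<in> Lp \<Omega> p" "g \<in> borel_measurable (lebesgue_on \<Omega>)" "AE x in lebesgue_on \<Omega>. f x = g x"
  shows "g \<in> Lp \<Omega> p"
proof -
  note [measurable] = assms(2)
  have "integrable (lebesgue_on \<Omega>) (\<lambda>x. norm (g x) powr p)"
  proof (rule Bochner_Integration.integrable_bound)
    show "integrable (lebesgue_on \<Omega>) (\<lambda>x. norm (f x) powr p)" using assms(1) by (simp add: Lp_def)
    show "AE x in lebesgue_on \<Omega>. norm (norm (g x) powr p) \<le> norm (norm (f x) powr p)"
      using assms(3) by (rule eventually_mono) simp
  qed measurable
  with assms(2) show ?thesis by (simp add: Lp_def)
qed

lemma Lp_norm_cong_AE: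
  assumes "f \<in> borel_measurable (lebesgue_on \<Omega>)" "g \<in> borel_measurable (lebesgue_on \<Omega>)"
    and "AE x in lebesgue_on \<Omega>. f x = g x"
  shows "Lp_norm \<Omega> p f = Lp_norm \<Omega> p g"
proof -
  note [measurable] = assms(1,2)
  have "(LINT x|lebesgue_on \<Omega>. norm (f x) powr p) = (LINT x|lebesgue_on \<Omega>. norm (g x) powr p)"
  proof (rule integral_cong_AE)
    show "AE x in lebesgue_on \<Omega>. norm (f x) powr p = norm (g x) powr p"
      using assms(3) by (rule eventually_mono) simp
  qed measurable
  then show ?thesis by (simp add: Lp_norm_def)
qed

text \<open>Membership follows from the crude bound |a - b|^p \<le> 2^p (|a|^p + |b|^p), a
  consequence of |a - b| \<le> 2 max(|a|, |b|).\<close>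

lemma Lp_diff:
  assumes "f \<in> Lp \<Omega> p" "g \<in> Lp \<Omega> p" "p > 0"
  shows "(\<lambda>x. f x - g x) \<in> Lp \<Omega> p"
proof -
  have [measurable]: "f \<in> borel_measurable (lebesgue_on \<Omega>)" "g \<in> borel_measurable (lebesgue_on \<Omega>)"
    using assms by (auto simp: Lp_def)
  have "integrable (lebesgue_on \<Omega>) (\<lambda>x. norm (f x - g x) powr p)"
  proof (rule Bochner_Integration.integrable_bound)
    show "integrable (lebesgue_on \<Omega>) (\<lambda>x. 2 powr p * (norm (f x) powr p + norm (g x) powr p))"
      using assms by (simp add: Lp_def)
    have "norm (f x - g x) powr p \<le> 2 powr p * (norm (f x) powr p + norm (g x) powr p)" for x
    proof -
      have "norm (f x - g x) powr p \<le> (2 * max (norm (f x)) (norm (g x))) powr p"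
        using norm_triangle_ineq4[of "f x" "g x"] assms(3) by (intro powr_mono2) auto
      also have "\<dots> = 2 powr p * max (norm (f x)) (norm (g x)) powr p"
        by (simp add: powr_mult)
      also have "max (norm (f x)) (norm (g x)) powr p \<le> norm (f x) powr p + norm (g x) powr p"
        by (simp add: max_def)
      finally show ?thesis by simp
    qed
    then show "AE x in lebesgue_on \<Omega>. norm (norm (f x - g x) powr p) \<le>
        norm (2 powr p * (norm (f x) powr p + norm (g x) powr p))"
      by (intro AE_I2) simp
  qed measurable
  then show ?thesis by (simp add: Lp_def)
qed

lemma finite_measure_lebesgue_on_bounded_open:
  assumes "open \<Omega>" "bounded \<Omega>"
  shows "finite_measure (lebesgue_on \<Omega>)"
  using lmeasurable_open[OF assms(2,1)] by (rule finite_measure_lebesgue_on)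

lemma bounded_continuous_Lp:
  fixes f :: "'a::euclidean_space \<Rightarrow> 'b::euclidean_space"
  assumes "open \<Omega>" "bounded \<Omega>" "p > 0" "continuous_on UNIV f" "\<And>x. norm (f x) \<le> B"
  shows "f \<in> Lp \<Omega> p"
proof -
  interpret finite_measure "lebesgue_on \<Omega>"
    using assms(1,2) by (rule finite_measure_lebesgue_on_bounded_open)
  have [measurable]: "f \<in> borel_measurable (lebesgue_on \<Omega>)"
    using assms(4) by (rule borel_measurable_lebesgue_on_continuous)
  have "integrable (lebesgue_on \<Omega>) (\<lambda>x. norm (f x) powr p)"
    using assms(3,5) by (intro integrable_const_bound[of _ "B powr p"] AE_I2) (auto intro!: powr_mono2)
  then show ?thesis by (simp add: Lp_def)
qed

text \<open>Split at the threshold \<delta>: where |f| \<le> \<delta>, its power r is at most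
  \<delta>^r; elsewhere |f|^r = |f|^(r - p) |f|^p with r - p \<le> 0. The free \<delta> is what
  makes the second claim usable for smallness.\<close>

lemma Lp_subset:
  fixes f :: "'a::euclidean_space \<Rightarrow> 'b::euclidean_space"
  assumes \<Omega>: "open \<Omega>" "bounded \<Omega>" and rp: "0 < r" "r \<le> p" and f: "f \<in> Lp \<Omega> p"
  shows "f \<in> Lp \<Omega> r"
    and "\<delta> > 0 \<Longrightarrow> (LINT x|lebesgue_on \<Omega>. norm (f x) powr r) \<le>
      \<delta> powr r * measure lebesgue \<Omega> + \<delta> powr (r - p) * (LINT x|lebesgue_on \<Omega>. norm (f x) powr p)"
proof -
  interpret finite_measure "lebesgue_on \<Omega>"
    using \<Omega> by (rule finite_measure_lebesgue_on_bounded_open)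
  have [measurable]: "f \<in> borel_measurable (lebesgue_on \<Omega>)"
    and int: "integrable (lebesgue_on \<Omega>) (\<lambda>x. norm (f x) powr p)"
    using f by (auto simp: Lp_def)
  have pointwise: "norm (f x) powr r \<le> \<delta> powr r + \<delta> powr (r - p) * norm (f x) powr p" if "\<delta> > 0" for \<delta> x
  proof (cases "norm (f x) \<le> \<delta>")
    case True
    then have "norm (f x) powr r \<le> \<delta> powr r" using rp by (intro powr_mono2) auto
    then show ?thesis by (simp add: add_increasing2)
  next
    case False
    then have "norm (f x) powr (r - p) \<le> \<delta> powr (r - p)"
      using rp that by (intro powr_mono2') auto
    then have "norm (f x) powr (r - p) * norm (f x) powr p \<le> \<delta> powr (r - p) * norm (f x) powr p"
      by (rule mult_right_mono) simp
    also have "norm (f x) powr (r - p) * norm (f x) powr p = norm (f x) powr r"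
      by (simp flip: powr_add)
    finally show ?thesis by (simp add: add_increasing)
  qed
  have int_r: "integrable (lebesgue_on \<Omega>) (\<lambda>x. norm (f x) powr r)"
  proof (rule Bochner_Integration.integrable_bound)
    show "integrable (lebesgue_on \<Omega>) (\<lambda>x. 1 + norm (f x) powr p)" using int by simp
    show "AE x in lebesgue_on \<Omega>. norm (norm (f x) powr r) \<le> norm (1 + norm (f x) powr p)"
      using pointwise[of 1] by (intro AE_I2) simp
  qed measurable
  then show "f \<in> Lp \<Omega> r" by (simp add: Lp_def)
  assume \<delta>: "\<delta> > 0"
  have "(LINT x|lebesgue_on \<Omega>. norm (f x) powr r) \<le>
      (LINT x|lebesgue_on \<Omega>. \<delta> powr r + \<delta> powr (r - p) * norm (f x) powr p)"
    using int int_r pointwise[OF \<delta>] by (intro integral_mono) auto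
  also have "\<dots> = \<delta> powr r * measure lebesgue \<Omega> + \<delta> powr (r - p) * (LINT x|lebesgue_on \<Omega>. norm (f x) powr p)"
    using int \<Omega>(1) by (simp add: measure_restrict_space)
  finally show "(LINT x|lebesgue_on \<Omega>. norm (f x) powr r) \<le>
      \<delta> powr r * measure lebesgue \<Omega> + \<delta> powr (r - p) * (LINT x|lebesgue_on \<Omega>. norm (f x) powr p)" .
qed

lemma Lp_norm_small:
  assumes \<Omega>: "open \<Omega>" "bounded \<Omega>" and rp: "0 < r" "r \<le> p" and "\<epsilon> > 0"
  obtains \<eta> where "\<eta> > 0"
    "\<And>f :: 'a::euclidean_space \<Rightarrow> 'b::euclidean_space. f \<in> Lp \<Omega> p \<Longrightarrow> Lp_norm \<Omega> p f < \<eta> \<Longrightarrow> Lp_norm \<Omega> r f < \<epsilon>"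
proof
  \<comment> \<open>Adding 1 keeps the denominator in \<delta> positive.\<close>
  define \<mu> where "\<mu> = measure lebesgue \<Omega> + 1"
  have \<mu>: "\<mu> > 0" "measure lebesgue \<Omega> \<le> \<mu>" by (auto simp: \<mu>_def add_nonneg_pos)
  \<comment> \<open>\<delta> and \<eta> solve \<delta>^r \<mu> = \<epsilon>^r / 2 and \<delta>^(r -
    p) \<eta>^p = \<epsilon>^r / 2, the shares granted to the two terms of the estimate in
    \<open>Lp_subset\<close>.\<close>
  define \<delta> where "\<delta> = (\<epsilon> powr r / (2 * \<mu>)) powr (1 / r)"
  have \<delta>: "\<delta> > 0" using \<mu> \<open>\<epsilon> > 0\<close> by (simp add: \<delta>_def)
  have \<delta>r: "\<delta> powr r = \<epsilon> powr r / (2 * \<mu>)" using rp \<mu> by (simp add: \<delta>_def powr_powr)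
  define \<eta> where "\<eta> = (\<epsilon> powr r / (2 * \<delta> powr (r - p))) powr (1 / p)"
  show "\<eta> > 0" using \<delta> \<open>\<epsilon> > 0\<close> by (simp add: \<eta>_def)
  have \<eta>p: "\<eta> powr p = \<epsilon> powr r / (2 * \<delta> powr (r - p))" using rp \<delta> by (simp add: \<eta>_def powr_powr)
  fix f :: "'a \<Rightarrow> 'b" assume f: "f \<in> Lp \<Omega> p" "Lp_norm \<Omega> p f < \<eta>"
  let ?I = "\<lambda>s. LINT x|lebesgue_on \<Omega>. norm (f x) powr s"
  have I: "?I s \<ge> 0" for s by (simp add: integral_nonneg_AE)
  have Ip: "?I p < \<epsilon> powr r / (2 * \<delta> powr (r - p))"
  proof -
    have "?I p = Lp_norm \<Omega> p f powr p" using rp I by (simp add: Lp_norm_def powr_powr)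
    also have "\<dots> < \<eta> powr p" using f(2) rp by (intro powr_less_mono2) (auto simp: Lp_norm_nonneg)
    finally show ?thesis by (simp add: \<eta>p)
  qed
  have "?I r \<le> \<delta> powr r * measure lebesgue \<Omega> + \<delta> powr (r - p) * ?I p"
    by (rule Lp_subset(2)[OF \<Omega> rp f(1) \<delta>])
  also have "\<dots> < \<epsilon> powr r / 2 + \<epsilon> powr r / 2"
  proof (rule add_le_less_mono)
    have "\<delta> powr r * measure lebesgue \<Omega> \<le> \<delta> powr r * \<mu>" using \<mu> by (intro mult_left_mono) auto
    then show "\<delta> powr r * measure lebesgue \<Omega> \<le> \<epsilon> powr r / 2" using \<mu> by (simp add: \<delta>r)
    show "\<delta> powr (r - p) * ?I p < \<epsilon> powr r / 2" using Ip \<delta> by (simp add: field_simps)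
  qed
  finally have "?I r < \<epsilon> powr r" by simp
  then have "?I r powr (1 / r) < (\<epsilon> powr r) powr (1 / r)"
    using rp I by (intro powr_less_mono2) auto
  then show "Lp_norm \<Omega> r f < \<epsilon>" using rp \<open>\<epsilon> > 0\<close> by (simp add: Lp_norm_def powr_powr)
qed

section \<open>Sobolev functions and zero boundary values\<close>

lemma W1p_norm_eq:
  assumes "open \<Omega>" "is_weak_gradient \<Omega> u g"
  shows "W1p_norm \<Omega> p u = Lp_norm \<Omega> p u + Lp_norm \<Omega> p g"
proof -
  note wg = weak_grad[OF assms]
  have "Lp_norm \<Omega> p (weak_grad \<Omega> u) = Lp_norm \<Omega> p g"
    using weak_gradient_measurable(2)[OF assms(1) wg(1)] weak_gradient_measurable(2)[OF assms] wg(2)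
    by (rule Lp_norm_cong_AE)
  then show ?thesis by (simp add: W1p_norm_def)
qed

text \<open>Membership in \<open>W1p\<close> provides some weak gradient in \<open>Lp\<close>;
  uniqueness transfers this to the chosen one.\<close>

lemma W1p_weak_grad:
  assumes "open \<Omega>" "u \<in> W1p \<Omega> p"
  shows "u \<in> Lp \<Omega> p" "is_weak_gradient \<Omega> u (weak_grad \<Omega> u)" "weak_grad \<Omega> u \<in> Lp \<Omega> p"
proof -
  obtain g where g: "is_weak_gradient \<Omega> u g" "g \<in> Lp \<Omega> p" and u: "u \<in> Lp \<Omega> p"
    using assms(2) by (auto simp: W1p_def)
  show "u \<in> Lp \<Omega> p" by (rule u)
  show wg: "is_weak_gradient \<Omega> u (weak_grad \<Omega> u)" by (rule weak_grad(1)[OF assms(1) g(1)])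
  have "AE x in lebesgue_on \<Omega>. g x = weak_grad \<Omega> u x"
    using weak_grad(2)[OF assms(1) g(1)] by (rule eventually_mono) simp
  with g(2) weak_gradient_measurable(2)[OF assms(1) wg] show "weak_grad \<Omega> u \<in> Lp \<Omega> p"
    by (rule Lp_cong_AE)
qed

lemma Cc_infty_Lp:
  assumes "open \<Omega>" "bounded \<Omega>" "p > 0" "\<phi> \<in> Cc_infty \<Omega>"
  shows "\<phi> \<in> Lp \<Omega> p" "grad \<phi> \<in> Lp \<Omega> p"
proof -
  obtain B where B: "\<And>x. \<bar>\<phi> x\<bar> \<le> B" "\<And>x. norm (grad \<phi> x) \<le> B"
    using Cc_infty_bounded[OF assms(4)] by metis
  show "\<phi> \<in> Lp \<Omega> p"
    by (rule bounded_continuous_Lp[OF assms(1-3) Cc_infty_continuous[OF assms(4)], of B]) (simp add: B)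
  show "grad \<phi> \<in> Lp \<Omega> p"
    by (rule bounded_continuous_Lp[OF assms(1-3) Cc_infty_continuous_grad[OF assms(4)], of B]) (simp add: B)
qed

lemma Cc_infty_subset_W1p_0:
  assumes "open \<Omega>" "bounded \<Omega>" "p > 0"
  shows "Cc_infty \<Omega> \<subseteq> W1p_0 \<Omega> p"
proof
  fix \<phi> assume \<phi>: "\<phi> \<in> Cc_infty \<Omega>"
  note g = is_weak_gradient_Cc_infty[OF assms(1) \<phi>]
  have "\<phi> \<in> W1p \<Omega> p" using Cc_infty_Lp[OF assms \<phi>] g by (auto simp: W1p_def)
  moreover have "W1p_norm \<Omega> p (\<lambda>x. \<phi> x - \<phi> x) = 0"
    using W1p_norm_eq[OF assms(1) is_weak_gradient_diff[OF assms(1) g g], of p] assms(3)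
    by (simp add: Lp_norm_def)
  ultimately show "\<phi> \<in> W1p_0 \<Omega> p" using \<phi> unfolding W1p_0_def by force
qed

text \<open>On a bounded set a small p-norm forces a small r-norm, so the test functions that
  approximate for p also serve r. This brings competitors from exponent p down to exponent 1, in
  terms of which \<open>W1psi_0\<close> is defined.\<close>

lemma W1p_0_mono:
  assumes \<Omega>: "open \<Omega>" "bounded \<Omega>" and rp: "0 < r" "r \<le> p"
  shows "W1p_0 \<Omega> p \<subseteq> W1p_0 \<Omega> r"
proof
  fix u assume u: "u \<in> W1p_0 \<Omega> p"
  then have "u \<in> W1p \<Omega> p" by (simp add: W1p_0_def)
  note wg = W1p_weak_grad[OF \<Omega>(1) this]
  show "u \<in> W1p_0 \<Omega> r"
    unfolding W1p_0_def
  proof (intro CollectI conjI allI impI)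
    show "u \<in> W1p \<Omega> r"
      using wg(2) Lp_subset(1)[OF \<Omega> rp wg(1)] Lp_subset(1)[OF \<Omega> rp wg(3)] by (auto simp: W1p_def)
    fix \<epsilon> :: real assume "\<epsilon> > 0"
    then have \<epsilon>2: "\<epsilon> / 2 > 0" by simp
    \<comment> \<open>Two instances of \<open>Lp_norm_small\<close>: one for scalar functions, one
      for vector fields.\<close>
    obtain \<eta>1 where \<eta>1: "\<eta>1 > 0"
      "\<And>f :: 'a \<Rightarrow> real. f \<in> Lp \<Omega> p \<Longrightarrow> Lp_norm \<Omega> p f < \<eta>1 \<Longrightarrow> Lp_norm \<Omega> r f < \<epsilon> / 2"
      using Lp_norm_small[OF \<Omega> rp \<epsilon>2] by blast
    obtain \<eta>2 where \<eta>2: "\<eta>2 > 0"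
      "\<And>f :: 'a \<Rightarrow> 'a. f \<in> Lp \<Omega> p \<Longrightarrow> Lp_norm \<Omega> p f < \<eta>2 \<Longrightarrow> Lp_norm \<Omega> r f < \<epsilon> / 2"
      using Lp_norm_small[OF \<Omega> rp \<epsilon>2] by blast
    obtain \<phi> where \<phi>: "\<phi> \<in> Cc_infty \<Omega>" "W1p_norm \<Omega> p (\<lambda>x. \<phi> x - u x) < min \<eta>1 \<eta>2"
    proof -
      have "min \<eta>1 \<eta>2 > 0" using \<eta>1(1) \<eta>2(1) by simp
      then show ?thesis using u that unfolding W1p_0_def by blast
    qed
    note eq = W1p_norm_eq[OF \<Omega>(1) is_weak_gradient_diff[OF \<Omega>(1) is_weak_gradient_Cc_infty[OF \<Omega>(1) \<phi>(1)] wg(2)]]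
    have p: "p > 0" using rp by simp
    note Lp = Lp_diff[OF Cc_infty_Lp(1)[OF \<Omega> p \<phi>(1)] wg(1) p] Lp_diff[OF Cc_infty_Lp(2)[OF \<Omega> p \<phi>(1)] wg(3) p]
    have "Lp_norm \<Omega> p (\<lambda>x. \<phi> x - u x) < \<eta>1" "Lp_norm \<Omega> p (\<lambda>x. grad \<phi> x - weak_grad \<Omega> u x) < \<eta>2"
      using \<phi>(2) Lp_norm_nonneg[of \<Omega> p "\<lambda>x. \<phi> x - u x"]
        Lp_norm_nonneg[of \<Omega> p "\<lambda>x. grad \<phi> x - weak_grad \<Omega> u x"] by (auto simp: eq)
    then have "W1p_norm \<Omega> r (\<lambda>x. \<phi> x - u x) < \<epsilon>"
      using \<eta>1(2)[OF Lp(1)] \<eta>2(2)[OF Lp(2)] by (simp add: eq)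
    with \<phi>(1) show "\<exists>\<phi>\<in>Cc_infty \<Omega>. W1p_norm \<Omega> r (\<lambda>x. \<phi> x - u x) < \<epsilon>" by blast
  qed
qed

lemma W1p_0_1_approximation:
  assumes \<Omega>: "open \<Omega>" and u: "u \<in> W1p_0 \<Omega> 1" and g: "is_weak_gradient \<Omega> u g"
  obtains \<phi> where "\<And>n::nat. \<phi> n \<in> Cc_infty \<Omega>"
    "(\<lambda>n. LINT x|lebesgue_on \<Omega>. norm (\<phi> n x - u x)) \<longlonglongrightarrow> 0"
    "(\<lambda>n. LINT x|lebesgue_on \<Omega>. norm (grad (\<phi> n) x - g x)) \<longlonglongrightarrow> 0"
proof -
  have "\<exists>\<phi>. \<phi> \<in> Cc_infty \<Omega> \<and> W1p_norm \<Omega> 1 (\<lambda>x. \<phi> x - u x) < inverse (real (Suc n))" for n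
    using u unfolding W1p_0_def by (auto simp: Bex_def)
  then obtain \<phi> where \<phi>: "\<And>n. \<phi> n \<in> Cc_infty \<Omega>"
    "\<And>n. W1p_norm \<Omega> 1 (\<lambda>x. \<phi> n x - u x) < inverse (real (Suc n))"
    by metis
  have eq: "W1p_norm \<Omega> 1 (\<lambda>x. \<phi> n x - u x) =
      (LINT x|lebesgue_on \<Omega>. norm (\<phi> n x - u x)) + (LINT x|lebesgue_on \<Omega>. norm (grad (\<phi> n) x - g x))" for n
    using W1p_norm_eq[OF \<Omega> is_weak_gradient_diff[OF \<Omega> is_weak_gradient_Cc_infty[OF \<Omega> \<phi>(1)] g]]
    by (simp add: Lp_norm_1)
  have nonneg: "0 \<le> (LINT x|lebesgue_on \<Omega>. norm (\<phi> n x - u x))"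
    "0 \<le> (LINT x|lebesgue_on \<Omega>. norm (grad (\<phi> n) x - g x))" for n
    by (rule integral_norm_nonneg)+
  have bound: "norm (LINT x|lebesgue_on \<Omega>. norm (\<phi> n x - u x)) \<le> inverse (real (Suc n))"
    "norm (LINT x|lebesgue_on \<Omega>. norm (grad (\<phi> n) x - g x)) \<le> inverse (real (Suc n))" for n
    using \<phi>(2)[of n] nonneg[of n] unfolding eq real_norm_def[of "integral\<^sup>L _ _"] by linarith+
  show ?thesis
    by (rule that[OF \<phi>(1) Lim_null_comparison[OF always_eventually[OF allI] LIMSEQ_inverse_real_of_nat]
          Lim_null_comparison[OF always_eventually[OF allI] LIMSEQ_inverse_real_of_nat]]) (rule bound)+
qed

text \<open>In the direction opposite to \<open>W1p_0_1_approximation\<close>: the L1 limit of the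
  gradients is automatically the weak gradient of the limit, so one approximation yields both a
  formula for the gradient and the zero boundary values.\<close>

lemma W1p_0_1_limit:
  fixes \<Omega> :: "'a::euclidean_space set"
  assumes \<Omega>: "open \<Omega>" "bounded \<Omega>" and \<phi>: "\<And>n::nat. \<phi> n \<in> Cc_infty \<Omega>"
    and v: "integrable (lebesgue_on \<Omega>) v" "(\<lambda>n. LINT x|lebesgue_on \<Omega>. norm (\<phi> n x - v x)) \<longlonglongrightarrow> 0"
    and G: "integrable (lebesgue_on \<Omega>) G" "(\<lambda>n. LINT x|lebesgue_on \<Omega>. norm (grad (\<phi> n) x - G x)) \<longlonglongrightarrow> 0"
  shows "is_weak_gradient \<Omega> v G" "v \<in> W1p_0 \<Omega> 1"
proof -
  have int: "integrable (lebesgue_on \<Omega>) (\<phi> n)" "integrable (lebesgue_on \<Omega>) (grad (\<phi> n))" for n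
    using Cc_infty_Lp[OF \<Omega> _ \<phi>, of 1] by (auto simp: Lp_1_iff)
  show wg: "is_weak_gradient \<Omega> v G"
    by (rule is_weak_gradient_L1_limit[OF \<Omega>(1) is_weak_gradient_Cc_infty[OF \<Omega>(1) \<phi>] int(1) v int(2) G])
  show "v \<in> W1p_0 \<Omega> 1"
    unfolding W1p_0_def
  proof (intro CollectI conjI allI impI)
    show "v \<in> W1p \<Omega> 1" using wg v(1) G(1) by (auto simp: W1p_def Lp_1_iff)
    fix \<epsilon> :: real assume "\<epsilon> > 0"
    have "(\<lambda>n. W1p_norm \<Omega> 1 (\<lambda>x. \<phi> n x - v x)) \<longlonglongrightarrow> 0 + 0"
      using W1p_norm_eq[OF \<Omega>(1) is_weak_gradient_diff[OF \<Omega>(1) is_weak_gradient_Cc_infty[OF \<Omega>(1) \<phi>] wg], of 1]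
        tendsto_add[OF v(2) G(2)]
      by (simp add: Lp_norm_1)
    then have "eventually (\<lambda>n. W1p_norm \<Omega> 1 (\<lambda>x. \<phi> n x - v x) < \<epsilon>) sequentially"
      using \<open>\<epsilon> > 0\<close> by (intro order_tendstoD(2)) auto
    then obtain n where "W1p_norm \<Omega> 1 (\<lambda>x. \<phi> n x - v x) < \<epsilon>"
      using eventually_happens'[OF sequentially_bot] by blast
    then show "\<exists>\<phi>\<in>Cc_infty \<Omega>. W1p_norm \<Omega> 1 (\<lambda>x. \<phi> x - v x) < \<epsilon>" using \<phi> by blast
  qed
qed

subsection \<open>Smooth truncation\<close>

lemma tanh_diff_le: "\<bar>tanh x - tanh y\<bar> \<le> \<bar>x - (y::real)\<bar>"
proof -
  have *: "\<bar>tanh x - tanh y\<bar> \<le> \<bar>x - y\<bar>" if less: "x < y" for x y :: real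
  proof -
    obtain z where "tanh y - tanh x = (y - x) * (1 - tanh z ^ 2)"
      using MVT2[OF less, of tanh "\<lambda>z. 1 - tanh z ^ 2"] DERIV_tanh_real by blast
    moreover have "\<bar>1 - tanh z ^ 2\<bar> \<le> 1"
      using tanh_real_bounds[of z] by (auto simp: abs_le_iff abs_square_le_1)
    ultimately show ?thesis
      by (metis abs_ge_zero abs_minus_commute abs_mult mult_left_le)
  qed
  show ?thesis using *[of x y] *[of y x] by (cases x y rule: linorder_cases) (auto simp: abs_minus_commute)
qed

lemma tanh_square_less_1: "tanh (x::real) ^ 2 < 1"
  using tanh_real_bounds[of x] by (simp add: abs_square_less_1 abs_less_iff)

definition smooth_truncation :: "real \<Rightarrow> real \<Rightarrow> real" where
  "smooth_truncation k s = k * tanh (s / k)"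

lemma abs_smooth_truncation_le: "k > 0 \<Longrightarrow> \<bar>smooth_truncation k s\<bar> \<le> k"
  using tanh_real_bounds[of "s / k"] by (simp add: smooth_truncation_def abs_mult abs_le_iff)

lemma smooth_truncation_diff_le:
  assumes "k > 0"
  shows "\<bar>smooth_truncation k s - smooth_truncation k t\<bar> \<le> \<bar>s - t\<bar>"
proof -
  have "\<bar>smooth_truncation k s - smooth_truncation k t\<bar> = k * \<bar>tanh (s / k) - tanh (t / k)\<bar>"
    using assms by (simp add: smooth_truncation_def abs_mult flip: right_diff_distrib)
  also have "\<dots> \<le> k * \<bar>s / k - t / k\<bar>"
    using assms tanh_diff_le by (intro mult_left_mono) auto
  also have "\<dots> = \<bar>s - t\<bar>" using assms by (simp add: abs_mult flip: diff_divide_distrib)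
  finally show ?thesis .
qed

lemma smooth_truncation_0 [simp]: "smooth_truncation k 0 = 0"
  by (simp add: smooth_truncation_def)

lemma DERIV_smooth_truncation:
  "k > 0 \<Longrightarrow> (smooth_truncation k has_field_derivative 1 - tanh (s / k) ^ 2) (at s)"
  unfolding smooth_truncation_def[abs_def]
  by (auto intro!: derivative_eq_intros)

text \<open>k tanh(s / k) vanishes only at s = 0, so truncation leaves the support
  unchanged.\<close>

lemma smooth_truncation_Cc_infty:
  assumes "k > 0" "\<phi> \<in> Cc_infty \<Omega>"
  shows "(\<lambda>x. smooth_truncation k (\<phi> x)) \<in> Cc_infty \<Omega>"
    and "grad (\<lambda>x. smooth_truncation k (\<phi> x)) x = (1 - tanh (\<phi> x / k) ^ 2) *\<^sub>R grad \<phi> x"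
proof -
  have "Ck n (\<lambda>x. smooth_truncation k (\<phi> x))" for n
    using assms(2) Ck_cmult[OF Ck_tanh[OF Ck_cmult[of n \<phi> "1 / k"]], of k]
    by (simp add: Cc_infty_def smooth_truncation_def)
  moreover have "{x. smooth_truncation k (\<phi> x) \<noteq> 0} = {x. \<phi> x \<noteq> 0}"
    using assms(1) by (auto simp: smooth_truncation_def)
  ultimately show "(\<lambda>x. smooth_truncation k (\<phi> x)) \<in> Cc_infty \<Omega>"
    using assms(2) by (simp add: Cc_infty_def)
  show "grad (\<lambda>x. smooth_truncation k (\<phi> x)) x = (1 - tanh (\<phi> x / k) ^ 2) *\<^sub>R grad \<phi> x"
    by (simp add: grad_def scaleR_sum_right
        partial_deriv_compose_real[OF Cc_infty_differentiable[OF assms(2)] DERIV_smooth_truncation[OF assms(1)]])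
qed

text \<open>With d the derivative of the truncation, d(\<phi>) grad \<phi> - d(u) g = d(\<phi>)
  (grad \<phi> - g) + (d(\<phi>) - d(u)) g. The first part tends to 0 in L1 because 0 \<le> d \<le>
  1, the second by dominated convergence with majorant |g|.\<close>

lemma smooth_truncation_W1p_0:
  fixes \<Omega> :: "'a::euclidean_space set"
  assumes \<Omega>: "open \<Omega>" "bounded \<Omega>" and k: "k > 0"
    and u: "u \<in> W1p_0 \<Omega> 1" and g: "is_weak_gradient \<Omega> u g"
  shows "is_weak_gradient \<Omega> (\<lambda>x. smooth_truncation k (u x)) (\<lambda>x. (1 - tanh (u x / k) ^ 2) *\<^sub>R g x)"
    and "(\<lambda>x. smooth_truncation k (u x)) \<in> W1p_0 \<Omega> 1"
proof -
  let ?L = "lebesgue_on \<Omega>"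
  let ?d = "\<lambda>s. 1 - tanh (s / k) ^ 2 :: real"
  have "u \<in> W1p \<Omega> 1" using u by (simp add: W1p_0_def)
  note wg = W1p_weak_grad[OF \<Omega>(1) this]
  have u_int: "integrable ?L u" using wg(1) by (simp add: Lp_1_iff)
  have g_int: "integrable ?L g"
    using Lp_cong_AE[OF wg(3) weak_gradient_measurable(2)[OF \<Omega>(1) g] weak_grad(2)[OF \<Omega>(1) g]]
    by (simp add: Lp_1_iff)
  note [measurable] = borel_measurable_integrable[OF u_int] borel_measurable_integrable[OF g_int]
  have tanh_measurable [measurable]: "(tanh :: real \<Rightarrow> real) \<in> borel_measurable borel"
    by (intro borel_measurable_continuous_onI continuous_on_tanh continuous_on_id) auto
  have d: "0 \<le> ?d s" "?d s \<le> 1" for s using tanh_square_less_1[of "s / k"] by auto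
  obtain \<phi>0 where \<phi>0: "\<And>n::nat. \<phi>0 n \<in> Cc_infty \<Omega>"
    "(\<lambda>n. LINT x|?L. norm (\<phi>0 n x - u x)) \<longlonglongrightarrow> 0"
    "(\<lambda>n. LINT x|?L. norm (grad (\<phi>0 n) x - g x)) \<longlonglongrightarrow> 0"
    by (rule W1p_0_1_approximation[OF \<Omega>(1) u g]) (rule that)
  have "integrable ?L (\<lambda>x. \<phi>0 n x - u x)" for n
    using Cc_infty_Lp(1)[OF \<Omega> _ \<phi>0(1), of 1] u_int by (simp add: Lp_1_iff)
  \<comment> \<open>The factor d(\<phi>) - d(u) calls for pointwise convergence almost everywhere,
    which L1 convergence supplies along a subsequence.\<close>
  from tendsto_L1_AE_subseq[OF this \<phi>0(2)] obtain r :: "nat \<Rightarrow> nat"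
    where r: "strict_mono r" "AE x in ?L. (\<lambda>n. \<phi>0 (r n) x - u x) \<longlonglongrightarrow> 0"
    by blast
  define \<phi> where "\<phi> n = \<phi>0 (r n)" for n
  have \<phi>: "\<phi> n \<in> Cc_infty \<Omega>" for n by (simp add: \<phi>_def \<phi>0)
  have \<phi>_lim: "(\<lambda>n. LINT x|?L. norm (\<phi> n x - u x)) \<longlonglongrightarrow> 0"
    "(\<lambda>n. LINT x|?L. norm (grad (\<phi> n) x - g x)) \<longlonglongrightarrow> 0"
    using LIMSEQ_subseq_LIMSEQ[OF \<phi>0(2) r(1)] LIMSEQ_subseq_LIMSEQ[OF \<phi>0(3) r(1)]
    by (simp_all add: \<phi>_def o_def)
  have \<phi>_AE: "AE x in ?L. (\<lambda>n. \<phi> n x) \<longlonglongrightarrow> u x"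
    using r(2) by (rule eventually_mono) (simp add: \<phi>_def LIM_zero_iff)
  have \<phi>_int: "integrable ?L (\<phi> n)" "integrable ?L (grad (\<phi> n))" for n
    using Cc_infty_Lp[OF \<Omega> _ \<phi>, of 1] by (auto simp: Lp_1_iff)
  note [measurable] = borel_measurable_integrable[OF \<phi>_int(1)] borel_measurable_integrable[OF \<phi>_int(2)]
  have trunc_int: "integrable ?L (\<lambda>x. smooth_truncation k (f x))" if "integrable ?L f" for f
  proof (rule Bochner_Integration.integrable_bound[OF that])
    show "(\<lambda>x. smooth_truncation k (f x)) \<in> borel_measurable ?L"
      using borel_measurable_integrable[OF that] unfolding smooth_truncation_def by measurable
    show "AE x in ?L. norm (smooth_truncation k (f x)) \<le> norm (f x)"
      using smooth_truncation_diff_le[OF k, of _ 0] by (intro AE_I2) simp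
  qed
  have d_int: "integrable ?L (\<lambda>x. ?d (f x) *\<^sub>R h x)"
    if "f \<in> borel_measurable ?L" "integrable ?L h" for f and h :: "'a \<Rightarrow> 'a"
  proof (rule Bochner_Integration.integrable_bound[OF that(2)])
    show "(\<lambda>x. ?d (f x) *\<^sub>R h x) \<in> borel_measurable ?L"
      using that(1) borel_measurable_integrable[OF that(2)] by measurable
    show "AE x in ?L. norm (?d (f x) *\<^sub>R h x) \<le> norm (h x)"
      using d by (intro AE_I2) (auto intro!: mult_left_le_one_le)
  qed
  have v_lim: "(\<lambda>n. LINT x|?L. norm (smooth_truncation k (\<phi> n x) - smooth_truncation k (u x))) \<longlonglongrightarrow> 0"
  proof (rule Lim_null_comparison[OF always_eventually[OF allI] \<phi>_lim(1)])
    fix n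
    have "(LINT x|?L. norm (smooth_truncation k (\<phi> n x) - smooth_truncation k (u x))) \<le>
        (LINT x|?L. norm (\<phi> n x - u x))"
      using smooth_truncation_diff_le[OF k]
      by (intro integral_mono integrable_norm Bochner_Integration.integrable_diff trunc_int \<phi>_int u_int) auto
    then show "norm (LINT x|?L. norm (smooth_truncation k (\<phi> n x) - smooth_truncation k (u x))) \<le>
        (LINT x|?L. norm (\<phi> n x - u x))"
      by simp
  qed
  have G_lim: "(\<lambda>n. LINT x|?L. norm (grad (\<lambda>x. smooth_truncation k (\<phi> n x)) x - ?d (u x) *\<^sub>R g x)) \<longlonglongrightarrow> 0"
  proof -
    have dom: "(\<lambda>n. LINT x|?L. norm ((?d (\<phi> n x) - ?d (u x)) *\<^sub>R g x)) \<longlonglongrightarrow> (LINT x|?L. 0)"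
    proof (rule integral_dominated_convergence[where w = "\<lambda>x. norm (g x)"])
      show "integrable ?L (\<lambda>x. norm (g x))" using g_int by simp
      show "AE x in ?L. (\<lambda>n. norm ((?d (\<phi> n x) - ?d (u x)) *\<^sub>R g x)) \<longlonglongrightarrow> 0"
        using \<phi>_AE
      proof (rule eventually_mono)
        fix x assume "(\<lambda>n. \<phi> n x) \<longlonglongrightarrow> u x"
        then have "(\<lambda>n. norm ((?d (\<phi> n x) - ?d (u x)) *\<^sub>R g x)) \<longlonglongrightarrow> norm ((?d (u x) - ?d (u x)) *\<^sub>R g x)"
          using k by (intro tendsto_intros) auto
        then show "(\<lambda>n. norm ((?d (\<phi> n x) - ?d (u x)) *\<^sub>R g x)) \<longlonglongrightarrow> 0" by simp
      qed
      have "\<bar>?d s - ?d t\<bar> \<le> 1" for s t using d[of s] d[of t] by linarith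
      then show "AE x in ?L. norm (norm ((?d (\<phi> n x) - ?d (u x)) *\<^sub>R g x)) \<le> norm (g x)" for n
        by (intro AE_I2) (auto intro!: mult_left_le_one_le)
    qed measurable
    show ?thesis
    proof (rule Lim_null_comparison[OF always_eventually[OF allI]])
      show "(\<lambda>n. (LINT x|?L. norm (grad (\<phi> n) x - g x)) +
          (LINT x|?L. norm ((?d (\<phi> n x) - ?d (u x)) *\<^sub>R g x))) \<longlonglongrightarrow> 0"
        using tendsto_add[OF \<phi>_lim(2) dom] by simp
      fix n
      have int1: "integrable ?L (\<lambda>x. norm (grad (\<phi> n) x - g x))"
        by (intro integrable_norm Bochner_Integration.integrable_diff \<phi>_int g_int)
      have "integrable ?L (\<lambda>x. norm (?d (\<phi> n x) *\<^sub>R g x - ?d (u x) *\<^sub>R g x))"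
        by (intro integrable_norm Bochner_Integration.integrable_diff d_int g_int) measurable
      then have int2: "integrable ?L (\<lambda>x. norm ((?d (\<phi> n x) - ?d (u x)) *\<^sub>R g x))"
        by (simp only: scaleR_left_diff_distrib)
      have int3: "integrable ?L (\<lambda>x. norm (?d (\<phi> n x) *\<^sub>R grad (\<phi> n) x - ?d (u x) *\<^sub>R g x))"
        by (intro integrable_norm Bochner_Integration.integrable_diff d_int g_int \<phi>_int) measurable
      have pointwise: "norm (?d s *\<^sub>R a - ?d t *\<^sub>R b) \<le> norm (a - b) + norm ((?d s - ?d t) *\<^sub>R b)"
        for s t and a b :: 'a
      proof -
        have "?d s *\<^sub>R a - ?d t *\<^sub>R b = ?d s *\<^sub>R (a - b) + (?d s - ?d t) *\<^sub>R b"
          by (simp add: scaleR_right_diff_distrib scaleR_left_diff_distrib)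
        also have "norm \<dots> \<le> norm (?d s *\<^sub>R (a - b)) + norm ((?d s - ?d t) *\<^sub>R b)"
          by (rule norm_triangle_ineq)
        also have "norm (?d s *\<^sub>R (a - b)) \<le> norm (a - b)"
          using d[of s] by (auto intro!: mult_left_le_one_le)
        finally show ?thesis by simp
      qed
      have "(LINT x|?L. norm (?d (\<phi> n x) *\<^sub>R grad (\<phi> n) x - ?d (u x) *\<^sub>R g x)) \<le>
          (LINT x|?L. norm (grad (\<phi> n) x - g x) + norm ((?d (\<phi> n x) - ?d (u x)) *\<^sub>R g x))"
        using int1 int2 int3 pointwise by (intro integral_mono Bochner_Integration.integrable_add)
      also have "\<dots> = (LINT x|?L. norm (grad (\<phi> n) x - g x)) +
          (LINT x|?L. norm ((?d (\<phi> n x) - ?d (u x)) *\<^sub>R g x))"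
        using int1 int2 by (rule Bochner_Integration.integral_add)
      finally show "norm (LINT x|?L. norm (grad (\<lambda>x. smooth_truncation k (\<phi> n x)) x - ?d (u x) *\<^sub>R g x)) \<le>
          (LINT x|?L. norm (grad (\<phi> n) x - g x)) + (LINT x|?L. norm ((?d (\<phi> n x) - ?d (u x)) *\<^sub>R g x))"
        by (simp only: smooth_truncation_Cc_infty(2)[OF k \<phi>] real_norm_def) (subst abs_of_nonneg, auto)
    qed
  qed
  show "is_weak_gradient \<Omega> (\<lambda>x. smooth_truncation k (u x)) (\<lambda>x. ?d (u x) *\<^sub>R g x)"
    "(\<lambda>x. smooth_truncation k (u x)) \<in> W1p_0 \<Omega> 1"
    by (rule W1p_0_1_limit[OF \<Omega> smooth_truncation_Cc_infty(1)[OF k \<phi>] trunc_int[OF u_int] v_lim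
          d_int[OF borel_measurable_integrable[OF u_int] g_int] G_lim])+
qed

subsection \<open>Generalized Young functions\<close>

lemma ennreal_linear_combination:
  "0 \<le> s \<Longrightarrow> 0 \<le> t \<Longrightarrow> 0 \<le> a \<Longrightarrow> 0 \<le> b \<Longrightarrow>
    ennreal (s * a + t * b) = ennreal s * ennreal a + ennreal t * ennreal b"
  by (simp add: ennreal_mult)

lemma nn_integral_linear_combination:
  "f \<in> borel_measurable M \<Longrightarrow> g \<in> borel_measurable M \<Longrightarrow>
    (\<integral>\<^sup>+x. s * f x + t * g x \<partial>M) = s * (\<integral>\<^sup>+x. f x \<partial>M) + t * (\<integral>\<^sup>+x. g x \<partial>M)"
  by (simp add: nn_integral_add nn_integral_cmult)

text \<open>C \<ge> 1 is a normalisation: it keeps coefficients such as \<open>C ^ n\<close> and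
  \<open>1 + t * C\<close> nonnegative, as their embedding into \<open>ennreal\<close>
  requires.\<close>

locale doubling_young_function =
  fixes \<Omega> :: "'a::euclidean_space set" and \<psi> :: "'a \<Rightarrow> real \<Rightarrow> real" and C :: real
  assumes open_domain: "open \<Omega>"
    and bounded_domain: "bounded \<Omega>"
    and nonneg: "\<And>x \<xi>. x \<in> \<Omega> \<Longrightarrow> 0 \<le> \<xi> \<Longrightarrow> 0 \<le> \<psi> x \<xi>"
    and measurable_section: "\<And>\<xi>. 0 \<le> \<xi> \<Longrightarrow> (\<lambda>x. \<psi> x \<xi>) \<in> borel_measurable (lebesgue_on \<Omega>)"
    and zero: "\<And>x. x \<in> \<Omega> \<Longrightarrow> \<psi> x 0 = 0"
    and convex: "\<And>x. x \<in> \<Omega> \<Longrightarrow> convex_on {0..} (\<psi> x)"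
    and C_ge_1: "1 \<le> C"
    and doubling: "\<And>x \<xi>. x \<in> \<Omega> \<Longrightarrow> 0 \<le> \<xi> \<Longrightarrow> \<psi> x (2 * \<xi>) \<le> C * \<psi> x \<xi>"
begin

abbreviation L :: "'a measure" where "L \<equiv> lebesgue_on \<Omega>"

text \<open>The energy as a functional of a vector field, so that sums and differences of fields can
  be estimated; \<open>energy_eq_modular\<close> returns to functions.\<close>

definition modular :: "('a \<Rightarrow> 'a) \<Rightarrow> ennreal" where
  "modular f = (\<integral>\<^sup>+x. ennreal (\<psi> x (norm (f x))) \<partial>L)"

lemma convex_combination:
  assumes "x \<in> \<Omega>" "0 \<le> t" "t \<le> 1" "0 \<le> a" "0 \<le> b"
  shows "\<psi> x ((1 - t) * a + t * b) \<le> (1 - t) * \<psi> x a + t * \<psi> x b"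
  using convex_onD[OF convex[OF assms(1)], of t a b] assms by simp

text \<open>Convexity between 0 and \<xi>, together with the value 0 at 0.\<close>

lemma scale_le:
  assumes "x \<in> \<Omega>" "0 \<le> t" "t \<le> 1" "0 \<le> \<xi>"
  shows "\<psi> x (t * \<xi>) \<le> t * \<psi> x \<xi>"
  using convex_combination[OF assms(1-3), of 0 \<xi>] assms by (simp add: zero)

text \<open>Monotonicity is derived: a is the multiple a / b of b, so \<open>scale_le\<close> and
  nonnegativity apply.\<close>

lemma mono:
  assumes "x \<in> \<Omega>" "0 \<le> a" "a \<le> b"
  shows "\<psi> x a \<le> \<psi> x b"
proof (cases "b = 0")
  case False
  then have b: "b > 0" using assms by simp
  have "\<psi> x ((a / b) * b) \<le> (a / b) * \<psi> x b" using assms b by (intro scale_le) auto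
  also have "\<dots> \<le> 1 * \<psi> x b" using assms b nonneg by (intro mult_right_mono) auto
  finally show ?thesis using b by simp
qed (use assms in simp)

text \<open>Measurability is known for sections at a fixed \<xi>. Rounding f down to multiples of 1
  / (n + 1) leaves countably many values, and continuity in \<xi> carries measurability to the
  limit.\<close>

lemma measurable_superposition:
  assumes f: "f \<in> borel_measurable L" and f_nonneg: "\<And>x. 0 \<le> f x"
  shows "(\<lambda>x. \<psi> x (f x)) \<in> borel_measurable L"
proof (rule borel_measurable_LIMSEQ_real)
  define s where "s n x = real_of_int \<lfloor>real (Suc n) * f x\<rfloor> / real (Suc n)" for n x
  have s: "0 \<le> s n x" for n x using f_nonneg by (simp add: s_def)
  have s_lim: "(\<lambda>n. s n x) \<longlonglongrightarrow> f x" for x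
  proof (rule LIM_zero_cancel, rule Lim_null_comparison[OF always_eventually[OF allI] LIMSEQ_inverse_real_of_nat])
    fix n
    have "s n x - f x = (real_of_int \<lfloor>real (Suc n) * f x\<rfloor> - real (Suc n) * f x) / real (Suc n)"
      by (simp add: s_def field_simps)
    also have "norm \<dots> \<le> 1 / real (Suc n)"
    proof -
      have "\<bar>real_of_int \<lfloor>real (Suc n) * f x\<rfloor> - real (Suc n) * f x\<bar> \<le> 1" by linarith
      then show ?thesis unfolding real_norm_def abs_divide by (intro frac_le) auto
    qed
    finally show "norm (s n x - f x) \<le> inverse (real (Suc n))" by (simp add: inverse_eq_divide)
  qed
  show "(\<lambda>n. \<psi> x (s n x)) \<longlonglongrightarrow> \<psi> x (f x)" if "x \<in> space L" for x
  \<comment> \<open>Convexity gives continuity on the open half-line; at \<open>f x = 0\<close> the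
    rounded values are exactly 0.\<close>
  proof (cases "f x = 0")
    case True
    then show ?thesis by (simp add: s_def)
  next
    case False
    then have "f x \<in> {0<..}" using f_nonneg[of x] by simp
    moreover have "continuous_on {0<..} (\<psi> x)"
      using convex[of x] that by (intro convex_on_continuous) (auto intro: convex_on_subset)
    ultimately have "isCont (\<psi> x) (f x)" by (simp add: continuous_on_eq_continuous_at)
    then show ?thesis using s_lim by (rule isCont_tendsto_compose)
  qed
  show "(\<lambda>x. \<psi> x (s n x)) \<in> borel_measurable L" for n
  proof -
    \<comment> \<open>The \<open>max 0\<close> makes every integer i admissible for
      \<open>measurable_section\<close>.\<close>
    have "(\<lambda>x. \<psi> x (max 0 (real_of_int \<lfloor>real (Suc n) * f x\<rfloor> / real (Suc n)))) \<in> borel_measurable L"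
    proof (rule measurable_compose_countable'[where I = UNIV
          and f = "\<lambda>i x. \<psi> x (max 0 (real_of_int i / real (Suc n)))"])
      show "(\<lambda>x. \<lfloor>real (Suc n) * f x\<rfloor>) \<in> L \<rightarrow>\<^sub>M count_space UNIV"
        using f by measurable
    qed (auto intro: measurable_section)
    then show ?thesis using s by (simp add: s_def max_absorb2)
  qed
qed

section \<open>The Luxemburg norm and the modular\<close>

lemma measurable_modular_integrand:
  assumes "f \<in> borel_measurable L" "0 < c"
  shows "(\<lambda>x. ennreal (\<psi> x (norm (f x) / c))) \<in> borel_measurable L"
  using assms by (intro measurable_compose[OF measurable_superposition measurable_ennreal]) auto

lemma psi_norm_le:
  "0 < c \<Longrightarrow> (\<integral>\<^sup>+x. ennreal (\<psi> x (norm (f x) / c)) \<partial>L) \<le> 1 \<Longrightarrow> psi_norm \<Omega> \<psi> f \<le> ennreal c"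
  unfolding psi_norm_def by (rule INF_lower) simp

text \<open>The admissible constants are closed upwards because \<psi> increases in \<xi>, so any
  number strictly above the infimum is admissible.\<close>

lemma psi_norm_less:
  assumes "psi_norm \<Omega> \<psi> f < ennreal a"
  shows "0 < a" "(\<integral>\<^sup>+x. ennreal (\<psi> x (norm (f x) / a)) \<partial>L) \<le> 1"
proof -
  obtain c where c: "0 < c" "(\<integral>\<^sup>+x. ennreal (\<psi> x (norm (f x) / c)) \<partial>L) \<le> 1" "ennreal c < ennreal a"
    using assms unfolding psi_norm_def INF_less_iff by auto
  then have "c < a" by (simp add: ennreal_less_iff)
  then show "0 < a" using c by simp
  have "(\<integral>\<^sup>+x. ennreal (\<psi> x (norm (f x) / a)) \<partial>L) \<le> (\<integral>\<^sup>+x. ennreal (\<psi> x (norm (f x) / c)) \<partial>L)"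
    using \<open>c < a\<close> c(1) by (intro nn_integral_mono ennreal_leI mono) (auto intro!: divide_left_mono)
  with c(2) show "(\<integral>\<^sup>+x. ennreal (\<psi> x (norm (f x) / a)) \<partial>L) \<le> 1" by simp
qed

lemma psi_norm_cong_AE:
  assumes "AE x in L. f x = g x"
  shows "psi_norm \<Omega> \<psi> f = psi_norm \<Omega> \<psi> g"
proof -
  have "(\<integral>\<^sup>+x. ennreal (\<psi> x (norm (f x) / c)) \<partial>L) = (\<integral>\<^sup>+x. ennreal (\<psi> x (norm (g x) / c)) \<partial>L)" for c
    by (rule nn_integral_cong_AE) (use assms in \<open>rule eventually_mono, simp\<close>)
  then show ?thesis by (simp add: psi_norm_def)
qed

text \<open>(|f| + |g|) / (a + b) is the convex combination of |f| / a and |g| / b with weights a /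
  (a + b) and b / (a + b). The strict hypotheses make a and b admissible.\<close>

lemma psi_norm_add_le:
  assumes f: "f \<in> borel_measurable L" "psi_norm \<Omega> \<psi> f < ennreal a"
    and g: "g \<in> borel_measurable L" "psi_norm \<Omega> \<psi> g < ennreal b"
  shows "psi_norm \<Omega> \<psi> (\<lambda>x. f x + g x) \<le> ennreal (a + b)"
proof (rule psi_norm_le)
  note a = psi_norm_less[OF f(2)] and b = psi_norm_less[OF g(2)]
  show "0 < a + b" using a b by simp
  let ?t = "b / (a + b)"
  have t: "0 \<le> ?t" "?t \<le> 1" "1 - ?t = a / (a + b)" using a(1) b(1) by (auto simp: field_simps)
  have "(\<integral>\<^sup>+x. ennreal (\<psi> x (norm (f x + g x) / (a + b))) \<partial>L) \<le>
    (\<integral>\<^sup>+x. ennreal (1 - ?t) * ennreal (\<psi> x (norm (f x) / a)) + ennreal ?t * ennreal (\<psi> x (norm (g x) / b)) \<partial>L)"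
  proof (rule nn_integral_mono)
    fix x assume "x \<in> space L"
    then have x: "x \<in> \<Omega>" by simp
    have "\<psi> x (norm (f x + g x) / (a + b)) \<le> \<psi> x ((1 - ?t) * (norm (f x) / a) + ?t * (norm (g x) / b))"
    proof (rule mono[OF x])
      have "norm (f x + g x) / (a + b) \<le> (norm (f x) + norm (g x)) / (a + b)"
        using a(1) b(1) norm_triangle_ineq by (intro divide_right_mono) auto
      also have "\<dots> = (1 - ?t) * (norm (f x) / a) + ?t * (norm (g x) / b)"
        unfolding t(3) using a(1) b(1) by (simp add: add_divide_distrib)
      finally show "norm (f x + g x) / (a + b) \<le> (1 - ?t) * (norm (f x) / a) + ?t * (norm (g x) / b)" .
    qed (use a(1) b(1) in auto)
    also have "\<dots> \<le> (1 - ?t) * \<psi> x (norm (f x) / a) + ?t * \<psi> x (norm (g x) / b)"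
      using a(1) b(1) t by (intro convex_combination[OF x]) auto
    finally have "ennreal (\<psi> x (norm (f x + g x) / (a + b))) \<le>
        ennreal ((1 - ?t) * \<psi> x (norm (f x) / a) + ?t * \<psi> x (norm (g x) / b))"
      by (rule ennreal_leI)
    also have "\<dots> = ennreal (1 - ?t) * ennreal (\<psi> x (norm (f x) / a)) + ennreal ?t * ennreal (\<psi> x (norm (g x) / b))"
      using t a(1) b(1) x by (intro ennreal_linear_combination) (auto simp: nonneg)
    finally show "ennreal (\<psi> x (norm (f x + g x) / (a + b))) \<le> \<dots>" .
  qed
  also have "\<dots> = ennreal (1 - ?t) * (\<integral>\<^sup>+x. ennreal (\<psi> x (norm (f x) / a)) \<partial>L) +
      ennreal ?t * (\<integral>\<^sup>+x. ennreal (\<psi> x (norm (g x) / b)) \<partial>L)"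
    by (rule nn_integral_linear_combination[OF measurable_modular_integrand[OF f(1) a(1)]
          measurable_modular_integrand[OF g(1) b(1)]])
  also have "\<dots> \<le> ennreal (1 - ?t) * 1 + ennreal ?t * 1"
    using a(2) b(2) by (intro add_mono mult_left_mono) auto
  also have "\<dots> = 1" using t(1,2) by (simp flip: ennreal_plus)
  finally show "(\<integral>\<^sup>+x. ennreal (\<psi> x (norm (f x + g x) / (a + b))) \<partial>L) \<le> 1" .
qed

lemma doubling_power:
  assumes "x \<in> \<Omega>" "0 \<le> \<xi>"
  shows "\<psi> x (2 ^ n * \<xi>) \<le> C ^ n * \<psi> x \<xi>"
proof (induction n)
  case (Suc n)
  have "\<psi> x (2 ^ Suc n * \<xi>) \<le> C * \<psi> x (2 ^ n * \<xi>)"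
    using doubling[OF assms(1), of "2 ^ n * \<xi>"] assms(2) by (simp add: mult.assoc)
  also have "\<dots> \<le> C * (C ^ n * \<psi> x \<xi>)" using Suc C_ge_1 by (intro mult_left_mono) auto
  finally show ?case by (simp add: mult.assoc)
qed simp

text \<open>A finite norm bounds the modular at one scale c; doubling n times, with 2^n above c / e,
  transports this to every scale e. It supplies the majorant in
  \<open>psi_norm_tendsto_0\<close>.\<close>

lemma psi_norm_finite_imp:
  assumes f: "f \<in> borel_measurable L" "psi_norm \<Omega> \<psi> f < \<infinity>" and "0 < e"
  shows "(\<integral>\<^sup>+x. ennreal (\<psi> x (norm (f x) / e)) \<partial>L) < \<infinity>"
proof -
  obtain c where c: "0 < c" "(\<integral>\<^sup>+x. ennreal (\<psi> x (norm (f x) / c)) \<partial>L) \<le> 1"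
    using f(2) unfolding psi_norm_def INF_less_iff by auto
  obtain n where n: "c / e < 2 ^ n" using real_arch_pow[of 2 "c / e"] by auto
  have "(\<integral>\<^sup>+x. ennreal (\<psi> x (norm (f x) / e)) \<partial>L) \<le>
      (\<integral>\<^sup>+x. ennreal (C ^ n) * ennreal (\<psi> x (norm (f x) / c)) \<partial>L)"
  proof (rule nn_integral_mono)
    fix x assume "x \<in> space L"
    then have x: "x \<in> \<Omega>" by simp
    have "norm (f x) / e = (c / e) * (norm (f x) / c)" using c(1) by simp
    also have "\<dots> \<le> 2 ^ n * (norm (f x) / c)" using n c(1) by (intro mult_right_mono) auto
    finally have "\<psi> x (norm (f x) / e) \<le> \<psi> x (2 ^ n * (norm (f x) / c))"
      using \<open>0 < e\<close> by (intro mono[OF x]) auto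
    also have "\<dots> \<le> C ^ n * \<psi> x (norm (f x) / c)" using c(1) by (intro doubling_power[OF x]) auto
    finally show "ennreal (\<psi> x (norm (f x) / e)) \<le> ennreal (C ^ n) * ennreal (\<psi> x (norm (f x) / c))"
      using C_ge_1 c(1) x by (simp add: nonneg flip: ennreal_mult)
  qed
  also have "\<dots> = ennreal (C ^ n) * (\<integral>\<^sup>+x. ennreal (\<psi> x (norm (f x) / c)) \<partial>L)"
    using measurable_modular_integrand[OF f(1) c(1)] by (rule nn_integral_cmult)
  also have "\<dots> \<le> ennreal (C ^ n) * 1" using c(2) by (rule mult_left_mono) simp
  also have "\<dots> < \<infinity>" by simp
  finally show ?thesis .
qed

text \<open>By \<open>scale_le\<close>, dividing the argument by c \<ge> 1 divides the modular by at
  least c; c = max 1 m brings it down to at most 1.\<close>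

lemma modular_finite_imp:
  assumes f: "f \<in> borel_measurable L" and fin: "modular f < \<infinity>"
  shows "psi_norm \<Omega> \<psi> f < \<infinity>"
proof -
  obtain m where m: "0 \<le> m" "modular f = ennreal m" using fin by (cases "modular f") auto
  define c where "c = max 1 m"
  have c: "1 \<le> c" "m \<le> c" by (auto simp: c_def)
  have meas: "(\<lambda>x. ennreal (\<psi> x (norm (f x)))) \<in> borel_measurable L"
    using measurable_modular_integrand[OF f, of 1] by simp
  have "(\<integral>\<^sup>+x. ennreal (\<psi> x (norm (f x) / c)) \<partial>L) \<le> (\<integral>\<^sup>+x. ennreal (1 / c) * ennreal (\<psi> x (norm (f x))) \<partial>L)"
  proof (rule nn_integral_mono)
    fix x assume "x \<in> space L"
    then have x: "x \<in> \<Omega>" by simp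
    have "\<psi> x (norm (f x) / c) \<le> (1 / c) * \<psi> x (norm (f x))"
      using scale_le[OF x, of "1 / c" "norm (f x)"] c by simp
    then show "ennreal (\<psi> x (norm (f x) / c)) \<le> ennreal (1 / c) * ennreal (\<psi> x (norm (f x)))"
      using c x by (simp add: nonneg flip: ennreal_mult)
  qed
  also have "\<dots> = ennreal (1 / c) * modular f"
    unfolding modular_def using meas by (rule nn_integral_cmult)
  also have "\<dots> = ennreal (m / c)" using m c by (simp flip: ennreal_mult)
  also have "\<dots> \<le> 1" using m c by simp
  finally have "psi_norm \<Omega> \<psi> f \<le> ennreal c" using c by (intro psi_norm_le) auto
  also have "\<dots> < \<infinity>" by simp
  finally show ?thesis .
qed

lemma psi_norm_mono:
  assumes "\<And>x. x \<in> \<Omega> \<Longrightarrow> norm (f x) \<le> norm (g x)"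
  shows "psi_norm \<Omega> \<psi> f \<le> psi_norm \<Omega> \<psi> g"
  unfolding psi_norm_def
proof (rule INF_superset_mono)
  show "{c. 0 < c \<and> (\<integral>\<^sup>+x. ennreal (\<psi> x (norm (g x) / c)) \<partial>L) \<le> 1} \<subseteq>
      {c. 0 < c \<and> (\<integral>\<^sup>+x. ennreal (\<psi> x (norm (f x) / c)) \<partial>L) \<le> 1}"
  proof safe
    fix c :: real assume c: "0 < c" "(\<integral>\<^sup>+x. ennreal (\<psi> x (norm (g x) / c)) \<partial>L) \<le> 1"
    have "(\<integral>\<^sup>+x. ennreal (\<psi> x (norm (f x) / c)) \<partial>L) \<le> (\<integral>\<^sup>+x. ennreal (\<psi> x (norm (g x) / c)) \<partial>L)"
      using assms c(1) by (intro nn_integral_mono ennreal_leI mono) (auto intro!: divide_right_mono)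
    then show "(\<integral>\<^sup>+x. ennreal (\<psi> x (norm (f x) / c)) \<partial>L) \<le> 1" using c(2) by simp
  qed
qed simp

text \<open>By \<open>scale_le\<close> the factor d comes out of \<psi>, leaving d times the
  integrable function \<psi>(x, |g| / e). Once the integral of this product drops below 1, e is an
  admissible constant.\<close>

lemma psi_norm_tendsto_0:
  fixes d :: "nat \<Rightarrow> 'a \<Rightarrow> real"
  assumes g: "g \<in> borel_measurable L" "psi_norm \<Omega> \<psi> g < \<infinity>"
    and d: "\<And>n. d n \<in> borel_measurable L" "\<And>n x. 0 \<le> d n x" "\<And>n x. d n x \<le> 1"
      "\<And>x. (\<lambda>n. d n x) \<longlonglongrightarrow> 0"
    and e: "0 < e"
  shows "eventually (\<lambda>n. psi_norm \<Omega> \<psi> (\<lambda>x. d n x *\<^sub>R g x) \<le> ennreal e) sequentially"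
proof -
  let ?w = "\<lambda>x. ennreal (\<psi> x (norm (g x) / e))"
  note w = measurable_modular_integrand[OF g(1) e]
  have "(\<lambda>n. \<integral>\<^sup>+x. ennreal (d n x) * ?w x \<partial>L) \<longlonglongrightarrow> (\<integral>\<^sup>+x. 0 \<partial>L)"
  proof (rule nn_integral_dominated_convergence[where w = ?w])
    show "(\<lambda>x. ennreal (d n x) * ?w x) \<in> borel_measurable L" for n
      using d(1)[of n] w by measurable
    show "(\<integral>\<^sup>+x. ?w x \<partial>L) < \<infinity>" by (rule psi_norm_finite_imp[OF g e])
    show "AE x in L. ennreal (d n x) * ?w x \<le> ?w x" for n
    proof (rule AE_I2)
      fix x
      show "ennreal (d n x) * ?w x \<le> ?w x"
        using mult_right_mono[of "ennreal (d n x)" 1 "?w x"] d(3)[of n x] by simp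
    qed
    show "AE x in L. (\<lambda>n. ennreal (d n x) * ?w x) \<longlonglongrightarrow> 0"
    proof (rule AE_I2)
      fix x assume "x \<in> space L"
      then have "ennreal (d n x) * ?w x = ennreal (d n x * \<psi> x (norm (g x) / e))" for n
        using d(2)[of n x] e by (simp add: ennreal_mult nonneg)
      moreover have "(\<lambda>n. ennreal (d n x * \<psi> x (norm (g x) / e))) \<longlonglongrightarrow> ennreal (0 * \<psi> x (norm (g x) / e))"
        by (intro tendsto_ennrealI tendsto_mult d(4) tendsto_const)
      ultimately show "(\<lambda>n. ennreal (d n x) * ?w x) \<longlonglongrightarrow> 0" by simp
    qed
  qed (use w in simp_all)
  then have "eventually (\<lambda>n. (\<integral>\<^sup>+x. ennreal (d n x) * ?w x \<partial>L) < 1) sequentially"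
    by (intro order_tendstoD(2)) auto
  then show ?thesis
  proof (rule eventually_mono)
    fix n assume less: "(\<integral>\<^sup>+x. ennreal (d n x) * ?w x \<partial>L) < 1"
    have "(\<integral>\<^sup>+x. ennreal (\<psi> x (norm (d n x *\<^sub>R g x) / e)) \<partial>L) \<le> (\<integral>\<^sup>+x. ennreal (d n x) * ?w x \<partial>L)"
    proof (rule nn_integral_mono)
      fix x assume "x \<in> space L"
      then have x: "x \<in> \<Omega>" by simp
      have "\<psi> x (norm (d n x *\<^sub>R g x) / e) \<le> d n x * \<psi> x (norm (g x) / e)"
        using scale_le[OF x d(2,3), of "norm (g x) / e" n] d(2)[of n x] e by simp
      then show "ennreal (\<psi> x (norm (d n x *\<^sub>R g x) / e)) \<le> ennreal (d n x) * ?w x"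
        using d(2)[of n x] e x by (simp add: nonneg flip: ennreal_mult)
    qed
    with less e show "psi_norm \<Omega> \<psi> (\<lambda>x. d n x *\<^sub>R g x) \<le> ennreal e"
      by (intro psi_norm_le) auto
  qed
qed

text \<open>Midpoint convexity at 2 |f| and 2 |g|, then doubling; the resulting factor C / 2 is
  relaxed to C.\<close>

lemma modular_add_le:
  assumes f: "f \<in> borel_measurable L" and g: "g \<in> borel_measurable L"
  shows "modular (\<lambda>x. f x + g x) \<le> ennreal C * (modular f + modular g)"
proof -
  have meas: "(\<lambda>x. ennreal (\<psi> x (norm (f x)))) \<in> borel_measurable L"
    "(\<lambda>x. ennreal (\<psi> x (norm (g x)))) \<in> borel_measurable L"
    using measurable_modular_integrand[OF f, of 1] measurable_modular_integrand[OF g, of 1] by auto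
  have "modular (\<lambda>x. f x + g x) \<le> (\<integral>\<^sup>+x. ennreal C * (ennreal (\<psi> x (norm (f x))) + ennreal (\<psi> x (norm (g x)))) \<partial>L)"
    unfolding modular_def
  proof (rule nn_integral_mono)
    fix x assume "x \<in> space L"
    then have x: "x \<in> \<Omega>" by simp
    have pos: "0 \<le> \<psi> x (norm (f x))" "0 \<le> \<psi> x (norm (g x))" using x by (auto simp: nonneg)
    have "\<psi> x (norm (f x + g x)) \<le> \<psi> x ((1 - 1 / 2) * (2 * norm (f x)) + 1 / 2 * (2 * norm (g x)))"
      using norm_triangle_ineq by (intro mono[OF x]) auto
    also have "\<dots> \<le> (1 - 1 / 2) * \<psi> x (2 * norm (f x)) + 1 / 2 * \<psi> x (2 * norm (g x))"
      by (intro convex_combination[OF x]) auto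
    also have "\<dots> \<le> 1 / 2 * (C * \<psi> x (norm (f x))) + 1 / 2 * (C * \<psi> x (norm (g x)))"
      using doubling[OF x, of "norm (f x)"] doubling[OF x, of "norm (g x)"] by simp
    also have "\<dots> \<le> C * (\<psi> x (norm (f x)) + \<psi> x (norm (g x)))"
      using mult_nonneg_nonneg[OF _ pos(1), of C] mult_nonneg_nonneg[OF _ pos(2), of C] C_ge_1
      by (simp add: distrib_left)
    finally show "ennreal (\<psi> x (norm (f x + g x))) \<le> ennreal C * (ennreal (\<psi> x (norm (f x))) + ennreal (\<psi> x (norm (g x))))"
      using pos C_ge_1 by (simp flip: ennreal_mult ennreal_plus)
  qed
  also have "\<dots> = ennreal C * (modular f + modular g)"
    unfolding modular_def using meas by (simp add: nn_integral_cmult nn_integral_add)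
  finally show ?thesis .
qed

lemma modular_uminus [simp]: "modular (\<lambda>x. - f x) = modular f"
  by (simp add: modular_def)

lemma modular_perturbation:
  assumes A: "A \<in> borel_measurable L" and e: "e \<in> borel_measurable L"
    and t: "0 < t" "t < 1 / 2" and small: "psi_norm \<Omega> \<psi> e < ennreal t"
  shows "modular (\<lambda>x. A x + e x) \<le> ennreal (1 + t * C) * modular A + ennreal t"
proof -
  have meas: "(\<lambda>x. ennreal (\<psi> x (norm (A x)))) \<in> borel_measurable L"
    using measurable_modular_integrand[OF A, of 1] by simp
  note meas_e = measurable_modular_integrand[OF e t(1)]
  \<comment> \<open>\<open>convex_combination\<close> is binary, so the three-term splitting is
    nested: |A| = (1 - t) z with z = (1 - r) |A| + r (2 |A|), which forces (1 - t) r = t. The bound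
    t < 1 / 2 yields r \<le> 1.\<close>
  define r where "r = t / (1 - t)"
  have r: "0 \<le> r" "r \<le> 1" "(1 - t) * r = t" using t by (auto simp: r_def field_simps)
  have "modular (\<lambda>x. A x + e x) \<le>
      (\<integral>\<^sup>+x. ennreal (1 + t * C) * ennreal (\<psi> x (norm (A x))) + ennreal t * ennreal (\<psi> x (norm (e x) / t)) \<partial>L)"
    unfolding modular_def
  proof (rule nn_integral_mono)
    fix x assume "x \<in> space L"
    then have x: "x \<in> \<Omega>" by simp
    have pos: "0 \<le> \<psi> x (norm (A x))" "0 \<le> \<psi> x (norm (e x) / t)" using x t by (auto simp: nonneg)
    let ?z = "(1 - r) * norm (A x) + r * (2 * norm (A x))"
    have z: "0 \<le> ?z" using r by simp
    have "(1 - t) * ?z = ((1 - t) + (1 - t) * r) * norm (A x)" by (simp add: algebra_simps)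
    then have tz: "(1 - t) * ?z = norm (A x)" by (simp add: r(3))
    have "\<psi> x (norm (A x + e x)) \<le> \<psi> x ((1 - t) * ?z + t * (norm (e x) / t))"
      unfolding tz using norm_triangle_ineq t by (intro mono[OF x]) auto
    also have "\<dots> \<le> (1 - t) * \<psi> x ?z + t * \<psi> x (norm (e x) / t)"
      using t z by (intro convex_combination[OF x]) auto
    also have "(1 - t) * \<psi> x ?z \<le> (1 - t) * ((1 - r) * \<psi> x (norm (A x)) + r * \<psi> x (2 * norm (A x)))"
      using t r by (intro mult_left_mono convex_combination[OF x]) auto
    also have "\<dots> = (1 - t - t) * \<psi> x (norm (A x)) + t * \<psi> x (2 * norm (A x))"
    proof -
      have "(1 - t) * ((1 - r) * a + r * b) = (1 - t - (1 - t) * r) * a + ((1 - t) * r) * b" for a b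
        by (simp add: algebra_simps)
      then show ?thesis unfolding r(3) .
    qed
    \<comment> \<open>The weight 1 - 2 t is relaxed to 1, and doubling absorbs the argument 2
      |A|.\<close>
    also have "\<dots> \<le> 1 * \<psi> x (norm (A x)) + t * (C * \<psi> x (norm (A x)))"
      using t pos doubling[OF x, of "norm (A x)"] by (intro add_mono mult_right_mono mult_left_mono) auto
    also have "\<dots> = (1 + t * C) * \<psi> x (norm (A x))" by (simp add: algebra_simps)
    finally have "\<psi> x (norm (A x + e x)) \<le> (1 + t * C) * \<psi> x (norm (A x)) + t * \<psi> x (norm (e x) / t)"
      by simp
    then show "ennreal (\<psi> x (norm (A x + e x))) \<le>
        ennreal (1 + t * C) * ennreal (\<psi> x (norm (A x))) + ennreal t * ennreal (\<psi> x (norm (e x) / t))"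
      using pos t C_ge_1 by (simp flip: ennreal_mult ennreal_plus)
  qed
  also have "\<dots> = ennreal (1 + t * C) * modular A + ennreal t * (\<integral>\<^sup>+x. ennreal (\<psi> x (norm (e x) / t)) \<partial>L)"
    unfolding modular_def using meas meas_e by (simp add: nn_integral_cmult nn_integral_add)
  also have "\<dots> \<le> ennreal (1 + t * C) * modular A + ennreal t * 1"
    using psi_norm_less(2)[OF small] by (intro add_left_mono mult_left_mono) auto
  finally show ?thesis by simp
qed

lemma energy_eq_modular: "is_weak_gradient \<Omega> u g \<Longrightarrow> energy \<Omega> \<psi> u = modular g"
  unfolding energy_def modular_def
  by (rule nn_integral_cong_AE) (drule weak_grad(2)[OF open_domain], erule eventually_mono, simp)

lemma psi_norm_weak_grad: "is_weak_gradient \<Omega> u g \<Longrightarrow> psi_norm \<Omega> \<psi> (weak_grad \<Omega> u) = psi_norm \<Omega> \<psi> g"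
  by (rule psi_norm_cong_AE) (rule weak_grad(2)[OF open_domain])

end

subsection \<open>Density and the absence of a Lavrentiev gap\<close>

text \<open>The truncation of s at level k equals s (tanh h / h) with h = s / k, and tanh has
  derivative 1 at 0. The case s = 0 is separate because h must avoid 0.\<close>

lemma smooth_truncation_tendsto:
  "(\<lambda>n. smooth_truncation (real (Suc n)) s) \<longlonglongrightarrow> s"
proof (cases "s = 0")
  case False
  have lim0: "(\<lambda>n. s / real (Suc n)) \<longlonglongrightarrow> 0"
    using tendsto_mult[OF tendsto_const LIMSEQ_inverse_real_of_nat, of s] by (simp add: divide_inverse)
  then have "filterlim (\<lambda>n. s / real (Suc n)) (at 0) sequentially"
    using False by (auto simp: filterlim_at)
  moreover have "((\<lambda>h. tanh h / h) \<longlongrightarrow> 1) (at (0::real))"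
    using DERIV_tanh_real[of 0] by (simp add: has_field_derivative_iff)
  ultimately have "(\<lambda>n. tanh (s / real (Suc n)) / (s / real (Suc n))) \<longlonglongrightarrow> 1"
    by (rule filterlim_compose[rotated])
  from tendsto_mult[OF tendsto_const this, of s] show ?thesis
    using False by (simp add: smooth_truncation_def mult.commute)
qed simp

context doubling_young_function
begin

lemma smooth_truncation_psi_approximation:
  assumes u: "u \<in> W1psi_0 \<Omega> \<psi>" and e: "0 < e"
  obtains v where "v \<in> W1psi_0 \<Omega> \<psi> \<inter> Linfty \<Omega>"
    "(\<integral>\<^sup>+x. ennreal \<bar>v x - u x\<bar> \<partial>L) < ennreal e"
    "psi_norm \<Omega> \<psi> (\<lambda>x. weak_grad \<Omega> v x - weak_grad \<Omega> u x) \<le> ennreal e"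
proof -
  define g where "g = weak_grad \<Omega> u"
  have u0: "u \<in> W1p_0 \<Omega> 1" and psi_g: "psi_norm \<Omega> \<psi> g < \<infinity>"
    using u by (auto simp: W1psi_0_def W1psi_def g_def)
  then have "u \<in> W1p \<Omega> 1" by (simp add: W1p_0_def)
  note wg = W1p_weak_grad[OF open_domain this, folded g_def]
  have u_int: "integrable L u" using wg(1) by (simp add: Lp_1_iff)
  have [measurable]: "u \<in> borel_measurable L" "g \<in> borel_measurable L"
    using weak_gradient_measurable[OF open_domain wg(2)] by auto
  have [measurable]: "(tanh :: real \<Rightarrow> real) \<in> borel_measurable borel"
    by (intro borel_measurable_continuous_onI continuous_on_tanh continuous_on_id) auto
  \<comment> \<open>\<open>d n\<close> is the loss of slope caused by truncation: grad u - grad (v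
    n) = \<open>d n\<close> times g almost everywhere, the form that
    \<open>psi_norm_tendsto_0\<close> expects.\<close>
  define d where "d n x = tanh (u x / real (Suc n)) ^ 2" for n x
  define v where "v n x = smooth_truncation (real (Suc n)) (u x)" for n x
  have d: "d n \<in> borel_measurable L" "0 \<le> d n x" "d n x \<le> 1" for n x
    using tanh_square_less_1[of "u x / real (Suc n)"] unfolding d_def by (measurable, auto)
  have d_lim: "(\<lambda>n. d n x) \<longlonglongrightarrow> 0" for x
  proof -
    have "(\<lambda>n. u x * inverse (real (Suc n))) \<longlonglongrightarrow> u x * 0"
      by (intro tendsto_mult tendsto_const LIMSEQ_inverse_real_of_nat)
    then have "(\<lambda>n. tanh (u x * inverse (real (Suc n))) ^ 2) \<longlonglongrightarrow> tanh (u x * 0) ^ 2"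
      by (intro tendsto_power tendsto_tanh) auto
    then show ?thesis by (simp add: d_def divide_inverse)
  qed
  have v: "is_weak_gradient \<Omega> (v n) (\<lambda>x. (1 - d n x) *\<^sub>R g x)" "v n \<in> W1p_0 \<Omega> 1" for n
    unfolding v_def d_def
    using smooth_truncation_W1p_0[OF open_domain bounded_domain _ u0 wg(2), of "real (Suc n)"] by auto
  \<comment> \<open>Truncation only shortens the gradient, so the Luxemburg norm stays
    finite.\<close>
  have v_psi: "v n \<in> W1psi_0 \<Omega> \<psi> \<inter> Linfty \<Omega>" for n
  proof -
    have "psi_norm \<Omega> \<psi> (weak_grad \<Omega> (v n)) \<le> psi_norm \<Omega> \<psi> g"
      unfolding psi_norm_weak_grad[OF v(1)]
      using d(2,3)[of n] by (intro psi_norm_mono) (auto intro!: mult_left_le_one_le)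
    then have "v n \<in> W1psi_0 \<Omega> \<psi>"
      using psi_g v(2)[of n] unfolding W1psi_0_def W1psi_def by (auto simp: W1p_0_def)
    moreover have "v n \<in> borel_measurable L"
      using weak_gradient_measurable(1)[OF open_domain v(1)] .
    moreover have "\<bar>v n x\<bar> \<le> real (Suc n)" for x
      unfolding v_def by (rule abs_smooth_truncation_le) simp
    ultimately show ?thesis by (auto simp: Linfty_def)
  qed
  have "(\<lambda>n. \<integral>\<^sup>+x. ennreal \<bar>v n x - u x\<bar> \<partial>L) \<longlonglongrightarrow> (\<integral>\<^sup>+x. 0 \<partial>L)"
  proof (rule nn_integral_dominated_convergence[where w = "\<lambda>x. ennreal (2 * \<bar>u x\<bar>)"])
    have "v n \<in> borel_measurable L" for n
      using weak_gradient_measurable(1)[OF open_domain v(1)] .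
    then show "(\<lambda>x. ennreal \<bar>v n x - u x\<bar>) \<in> borel_measurable L" for n by measurable
    show "(\<integral>\<^sup>+x. ennreal (2 * \<bar>u x\<bar>) \<partial>L) < \<infinity>"
      by (subst nn_integral_eq_integral[OF integrable_mult_right[OF integrable_abs[OF u_int]]]) simp_all
    \<comment> \<open>The truncation fixes 0 and is 1-Lipschitz, hence |v n| \<le> |u|.\<close>
    have "\<bar>v n x - u x\<bar> \<le> 2 * \<bar>u x\<bar>" for n x
      using smooth_truncation_diff_le[of "real (Suc n)" "u x" 0] by (simp add: v_def)
    then show "AE x in L. ennreal \<bar>v n x - u x\<bar> \<le> ennreal (2 * \<bar>u x\<bar>)" for n
      by (intro AE_I2 ennreal_leI)
    show "AE x in L. (\<lambda>n. ennreal \<bar>v n x - u x\<bar>) \<longlonglongrightarrow> 0"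
    proof (rule AE_I2)
      fix x
      have "(\<lambda>n. ennreal \<bar>v n x - u x\<bar>) \<longlonglongrightarrow> ennreal \<bar>u x - u x\<bar>"
        unfolding v_def by (intro tendsto_ennrealI tendsto_rabs tendsto_diff smooth_truncation_tendsto tendsto_const)
      then show "(\<lambda>n. ennreal \<bar>v n x - u x\<bar>) \<longlonglongrightarrow> 0" by simp
    qed
  qed simp_all
  then have "eventually (\<lambda>n. (\<integral>\<^sup>+x. ennreal \<bar>v n x - u x\<bar> \<partial>L) < ennreal e) sequentially"
    using e by (intro order_tendstoD(2)) auto
  moreover have "eventually (\<lambda>n. psi_norm \<Omega> \<psi> (\<lambda>x. d n x *\<^sub>R g x) \<le> ennreal e) sequentially"
    by (rule psi_norm_tendsto_0[OF _ psi_g d d_lim e]) simp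
  ultimately have "eventually (\<lambda>n. (\<integral>\<^sup>+x. ennreal \<bar>v n x - u x\<bar> \<partial>L) < ennreal e \<and>
      psi_norm \<Omega> \<psi> (\<lambda>x. d n x *\<^sub>R g x) \<le> ennreal e) sequentially"
    by (rule eventually_conj)
  then obtain n where n: "(\<integral>\<^sup>+x. ennreal \<bar>v n x - u x\<bar> \<partial>L) < ennreal e"
      "psi_norm \<Omega> \<psi> (\<lambda>x. d n x *\<^sub>R g x) \<le> ennreal e"
    using eventually_happens'[OF sequentially_bot] by blast
  have "psi_norm \<Omega> \<psi> (\<lambda>x. weak_grad \<Omega> (v n) x - g x) = psi_norm \<Omega> \<psi> (\<lambda>x. (1 - d n x) *\<^sub>R g x - g x)"
    by (rule psi_norm_cong_AE, rule eventually_mono[OF weak_grad(2)[OF open_domain v(1)]]) simp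
  also have "\<dots> \<le> psi_norm \<Omega> \<psi> (\<lambda>x. d n x *\<^sub>R g x)"
    by (rule psi_norm_mono) (simp add: scaleR_left_diff_distrib)
  also have "\<dots> \<le> ennreal e" by (rule n(2))
  finally show ?thesis using that v_psi n(1) unfolding g_def by blast
qed

lemma W1psi_norm_diff:
  assumes "is_weak_gradient \<Omega> u g" "is_weak_gradient \<Omega> v h"
  shows "W1psi_norm \<Omega> \<psi> (\<lambda>x. u x - v x) =
    (\<integral>\<^sup>+x. ennreal \<bar>u x - v x\<bar> \<partial>L) + psi_norm \<Omega> \<psi> (\<lambda>x. g x - h x)"
  using psi_norm_weak_grad[OF is_weak_gradient_diff[OF open_domain assms]]
  by (simp add: W1psi_norm_def)

lemma Cc_infty_approximation:
  assumes bounded_approx: "\<And>u. u \<in> W1psi_0 \<Omega> \<psi> \<inter> Linfty \<Omega> \<Longrightarrow>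
      \<exists>U :: nat \<Rightarrow> 'a \<Rightarrow> real. (\<forall>n. U n \<in> Cc_infty \<Omega>) \<and>
        (\<lambda>n. W1psi_norm \<Omega> \<psi> (\<lambda>x. U n x - u x)) \<longlonglongrightarrow> 0"
    and u: "u \<in> W1psi_0 \<Omega> \<psi>" and \<epsilon>: "0 < \<epsilon>"
  shows "\<exists>\<phi>\<in>Cc_infty \<Omega>. W1psi_norm \<Omega> \<psi> (\<lambda>x. \<phi> x - u x) < \<epsilon>"
proof -
  \<comment> \<open>\<epsilon> may be infinite, so a finite bound is placed below it.\<close>
  obtain b where b: "0 < b" "b < \<epsilon>" using dense[OF \<epsilon>] by blast
  then obtain c where c: "0 \<le> c" "b = ennreal c" by (cases b) auto
  \<comment> \<open>Five shares: one for each of the L1 errors of U - v and v - u, one for the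
    gradient error of U - v, and two for that of v - u, whose bound is not strict whereas
    \<open>psi_norm_add_le\<close> asks for a strict one.\<close>
  define e where "e = c / 5"
  have e: "0 < e" using b c by (simp add: e_def ennreal_less_zero_iff)
  obtain v where v: "v \<in> W1psi_0 \<Omega> \<psi> \<inter> Linfty \<Omega>"
    "(\<integral>\<^sup>+x. ennreal \<bar>v x - u x\<bar> \<partial>L) < ennreal e"
    "psi_norm \<Omega> \<psi> (\<lambda>x. weak_grad \<Omega> v x - weak_grad \<Omega> u x) \<le> ennreal e"
    using smooth_truncation_psi_approximation[OF u e] by blast
  obtain U :: "nat \<Rightarrow> 'a \<Rightarrow> real" where U: "\<And>n. U n \<in> Cc_infty \<Omega>"
    "(\<lambda>n. W1psi_norm \<Omega> \<psi> (\<lambda>x. U n x - v x)) \<longlonglongrightarrow> 0"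
    using bounded_approx[OF v(1)] by blast
  have "eventually (\<lambda>n. W1psi_norm \<Omega> \<psi> (\<lambda>x. U n x - v x) < ennreal e) sequentially"
    using U(2) e by (intro order_tendstoD(2)) auto
  then obtain n where n: "W1psi_norm \<Omega> \<psi> (\<lambda>x. U n x - v x) < ennreal e"
    using eventually_happens'[OF sequentially_bot] by blast
  have "u \<in> W1p \<Omega> 1" "v \<in> W1p \<Omega> 1" using u v(1) by (auto simp: W1psi_0_def W1psi_def)
  note gu = W1p_weak_grad(2)[OF open_domain this(1)] and gv = W1p_weak_grad(2)[OF open_domain this(2)]
  note gU = is_weak_gradient_Cc_infty[OF open_domain U(1)[of n]]
  note [measurable] = weak_gradient_measurable[OF open_domain gu] weak_gradient_measurable[OF open_domain gv]
    weak_gradient_measurable[OF open_domain gU]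
  have Uv: "(\<integral>\<^sup>+x. ennreal \<bar>U n x - v x\<bar> \<partial>L) \<le> ennreal e"
    "psi_norm \<Omega> \<psi> (\<lambda>x. grad (U n) x - weak_grad \<Omega> v x) < ennreal e"
    using n unfolding W1psi_norm_diff[OF gU gv]
    by (auto intro: le_less_trans[OF add_increasing] le_less_trans[OF add_increasing2] order.strict_implies_order
        elim!: le_less_trans[rotated])
  have "psi_norm \<Omega> \<psi> (\<lambda>x. weak_grad \<Omega> v x - weak_grad \<Omega> u x) < ennreal (2 * e)"
    using v(3) e by (intro le_less_trans[OF v(3)]) (simp add: ennreal_less_iff)
  then have "psi_norm \<Omega> \<psi> (\<lambda>x. (grad (U n) x - weak_grad \<Omega> v x) + (weak_grad \<Omega> v x - weak_grad \<Omega> u x))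
      \<le> ennreal (e + 2 * e)"
    by (intro psi_norm_add_le Uv(2)) measurable
  then have psi: "psi_norm \<Omega> \<psi> (\<lambda>x. grad (U n) x - weak_grad \<Omega> u x) \<le> ennreal (3 * e)" by simp
  have "(\<integral>\<^sup>+x. ennreal \<bar>U n x - u x\<bar> \<partial>L) \<le> (\<integral>\<^sup>+x. ennreal \<bar>U n x - v x\<bar> + ennreal \<bar>v x - u x\<bar> \<partial>L)"
    by (intro nn_integral_mono) (simp flip: ennreal_plus)
  also have "\<dots> = (\<integral>\<^sup>+x. ennreal \<bar>U n x - v x\<bar> \<partial>L) + (\<integral>\<^sup>+x. ennreal \<bar>v x - u x\<bar> \<partial>L)"
    by (rule nn_integral_add) measurable
  also have "\<dots> \<le> ennreal e + ennreal e" using Uv(1) v(2) by (intro add_mono) auto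
  finally have "W1psi_norm \<Omega> \<psi> (\<lambda>x. U n x - u x) \<le> (ennreal e + ennreal e) + ennreal (3 * e)"
    unfolding W1psi_norm_diff[OF gU gu] using psi by (rule add_mono)
  also have "\<dots> = ennreal c" using e by (simp add: e_def flip: ennreal_plus)
  also have "\<dots> < \<epsilon>" using b c by simp
  finally show ?thesis using U(1) by blast
qed

text \<open>The domain has finite measure, so the constant term of the growth bound is
  integrable.\<close>

lemma modular_finite_of_growth:
  assumes growth: "\<And>x \<xi>. x \<in> \<Omega> \<Longrightarrow> 0 \<le> \<xi> \<Longrightarrow> \<psi> x \<xi> \<le> c * (1 + \<xi> powr q)" and c: "0 < c"
    and f: "f \<in> Lp \<Omega> q"
  shows "modular f < \<infinity>"
proof -
  interpret finite_measure L
    using open_domain bounded_domain by (rule finite_measure_lebesgue_on_bounded_open)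
  have int: "integrable L (\<lambda>x. c * (1 + norm (f x) powr q))"
    using f by (simp add: Lp_def)
  have "modular f \<le> (\<integral>\<^sup>+x. ennreal (c * (1 + norm (f x) powr q)) \<partial>L)"
    unfolding modular_def using growth by (intro nn_integral_mono ennreal_leI) auto
  also have "\<dots> = ennreal (LINT x|L. c * (1 + norm (f x) powr q))"
    using c by (intro nn_integral_eq_integral[OF int] AE_I2) (simp add: add_nonneg_nonneg)
  also have "\<dots> < \<infinity>" by simp
  finally show ?thesis .
qed

lemma Cc_infty_subset_W1psi_0:
  assumes growth: "\<And>x \<xi>. x \<in> \<Omega> \<Longrightarrow> 0 \<le> \<xi> \<Longrightarrow> \<psi> x \<xi> \<le> c * (1 + \<xi> powr q)" and c: "0 < c" and q: "0 < q"
  shows "Cc_infty \<Omega> \<subseteq> W1psi_0 \<Omega> \<psi>"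
proof
  fix \<phi> assume \<phi>: "\<phi> \<in> Cc_infty \<Omega>"
  have 1: "\<phi> \<in> W1p_0 \<Omega> 1" using Cc_infty_subset_W1p_0[OF open_domain bounded_domain, of 1] \<phi> by auto
  note g = is_weak_gradient_Cc_infty[OF open_domain \<phi>]
  have "modular (grad \<phi>) < \<infinity>"
    using growth c Cc_infty_Lp(2)[OF open_domain bounded_domain q \<phi>] by (rule modular_finite_of_growth)
  then have "psi_norm \<Omega> \<psi> (weak_grad \<Omega> \<phi>) < \<infinity>"
    unfolding psi_norm_weak_grad[OF g] using weak_gradient_measurable(2)[OF open_domain g]
    by (intro modular_finite_imp)
  with 1 show "\<phi> \<in> W1psi_0 \<Omega> \<psi>" by (auto simp: W1psi_0_def W1psi_def W1p_0_def)
qed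

text \<open>A competitor of infinite energy is trivial. Otherwise finiteness of the energy E lets
  the bound (1 + t C) E + t shrink to E as t tends to 0.\<close>

lemma infimum_le_energy:
  assumes bounded_approx: "\<And>u. u \<in> W1psi_0 \<Omega> \<psi> \<inter> Linfty \<Omega> \<Longrightarrow>
      \<exists>U :: nat \<Rightarrow> 'a \<Rightarrow> real. (\<forall>n. U n \<in> Cc_infty \<Omega>) \<and>
        (\<lambda>n. W1psi_norm \<Omega> \<psi> (\<lambda>x. U n x - u x)) \<longlonglongrightarrow> 0"
    and u0: "is_weak_gradient \<Omega> u\<^sub>0 g\<^sub>0" "modular g\<^sub>0 < \<infinity>" and w: "w \<in> W1p_0 \<Omega> 1"
  shows "(INF u\<in>translate u\<^sub>0 (Cc_infty \<Omega>). energy \<Omega> \<psi> u) \<le> energy \<Omega> \<psi> (\<lambda>x. u\<^sub>0 x + w x)"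
    (is "?I \<le> ?E")
proof (cases "?E = \<infinity>")
  case False
  have "w \<in> W1p \<Omega> 1" using w by (simp add: W1p_0_def)
  note gw = W1p_weak_grad(2)[OF open_domain this]
  define h where "h = weak_grad \<Omega> w"
  note gw = gw[folded h_def]
  note [measurable] = weak_gradient_measurable[OF open_domain u0(1)] weak_gradient_measurable[OF open_domain gw]
  let ?A = "\<lambda>x. g\<^sub>0 x + h x"
  have E: "?E = modular ?A"
    by (rule energy_eq_modular[OF is_weak_gradient_add[OF open_domain u0(1) gw]])
  obtain m where m: "0 \<le> m" "?E = ennreal m" using False by (cases ?E) auto
  \<comment> \<open>The gradient of w is the difference of two fields of finite modular, the total
    gradient and that of \<open>u\<^sub>0\<close>.\<close>
  have "modular h = modular (\<lambda>x. ?A x + - g\<^sub>0 x)" by simp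
  also have "\<dots> \<le> ennreal C * (modular ?A + modular (\<lambda>x. - g\<^sub>0 x))"
    by (rule modular_add_le) measurable
  also have "\<dots> < \<infinity>" using u0(2) m E by (simp add: ennreal_mult_less_top less_top)
  finally have "psi_norm \<Omega> \<psi> h < \<infinity>" by (intro modular_finite_imp) auto
  then have w_psi: "w \<in> W1psi_0 \<Omega> \<psi>"
    using w by (auto simp: W1psi_0_def W1psi_def W1p_0_def h_def)
  have bound: "?I \<le> ennreal (1 + t * C) * ?E + ennreal t" if t: "0 < t" "t < 1 / 2" for t
  proof -
    obtain \<phi> where \<phi>: "\<phi> \<in> Cc_infty \<Omega>" "W1psi_norm \<Omega> \<psi> (\<lambda>x. \<phi> x - w x) < ennreal t"
      using Cc_infty_approximation[OF bounded_approx w_psi, of "ennreal t"] t by auto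
    note g\<phi> = is_weak_gradient_Cc_infty[OF open_domain \<phi>(1)]
    note [measurable] = weak_gradient_measurable[OF open_domain g\<phi>]
    have small: "psi_norm \<Omega> \<psi> (\<lambda>x. grad \<phi> x - h x) < ennreal t"
      using \<phi>(2) unfolding W1psi_norm_diff[OF g\<phi> gw] by (rule le_less_trans[rotated]) simp
    have "?I \<le> energy \<Omega> \<psi> (\<lambda>x. u\<^sub>0 x + \<phi> x)"
      using \<phi>(1) by (intro INF_lower) (auto simp: translate_def)
    also have "\<dots> = modular (\<lambda>x. ?A x + (grad \<phi> x - h x))"
      using energy_eq_modular[OF is_weak_gradient_add[OF open_domain u0(1) g\<phi>]] by simp
    also have "\<dots> \<le> ennreal (1 + t * C) * modular ?A + ennreal t"
      by (rule modular_perturbation[OF _ _ t small]) measurable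
    finally show ?thesis unfolding E .
  qed
  show ?thesis
  proof (rule ennreal_le_epsilon)
    fix \<delta> :: real assume \<delta>: "0 < \<delta>"
    have K: "C * m + 1 > 0" using C_ge_1 m by (simp add: add_nonneg_pos)
    \<comment> \<open>The entry 1 / 3 secures t < 1 / 2. The other one gives t (C m + 1) \<le>
      \<delta>, which fits because (1 + t C) m + t = m + t (C m + 1).\<close>
    define t where "t = min (1 / 3) (\<delta> / (C * m + 1))"
    have t: "0 < t" "t < 1 / 2" "t \<le> \<delta> / (C * m + 1)" using \<delta> K by (auto simp: t_def)
    have "?I \<le> ennreal (1 + t * C) * ennreal m + ennreal t" using bound[OF t(1,2)] unfolding m(2) .
    also have "\<dots> = ennreal (m + t * (C * m + 1))"
      using t(1) C_ge_1 m(1) by (simp add: algebra_simps flip: ennreal_mult ennreal_plus)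
    also have "\<dots> \<le> ennreal (m + \<delta>)" using t(3) K by (intro ennreal_leI) (simp add: field_simps)
    also have "\<dots> = ?E + ennreal \<delta>" using m \<delta> by simp
    finally show "?I \<le> ?E + ennreal \<delta>" .
  qed
qed simp

end

theorem lemma4p3:
  fixes \<Omega> :: "'a::euclidean_space set"
    and \<psi> :: "'a \<Rightarrow> real \<Rightarrow> real"
    and p q :: real
  assumes domain: "bounded_lipschitz_domain \<Omega>"
    and exponents: "1 < p" "p < q"
    and psi_nonneg: "\<And>x \<xi>. x \<in> \<Omega> \<Longrightarrow> 0 \<le> \<xi> \<Longrightarrow> 0 \<le> \<psi> x \<xi>"
    and psi_measurable: "\<And>\<xi>. 0 \<le> \<xi> \<Longrightarrow> (\<lambda>x. \<psi> x \<xi>) \<in> borel_measurable (lebesgue_on \<Omega>)"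
    and A1: "\<And>x \<xi>. x \<in> \<Omega> \<Longrightarrow> 0 \<le> \<xi> \<Longrightarrow> \<psi> x \<xi> = 0 \<longleftrightarrow> \<xi> = 0"
    and A2: "\<And>x. x \<in> \<Omega> \<Longrightarrow> convex_on {0..} (\<psi> x)"
    and A3: "\<exists>m :: real \<Rightarrow> real. strict_mono_on {0..} m \<and> continuous_on {0..} m \<and> m 0 = 0 \<and>
               (\<forall>x\<in>\<Omega>. \<forall>\<xi>\<ge>0. m \<xi> \<le> \<psi> x \<xi>) \<and> filterlim (\<lambda>\<xi>. m \<xi> / \<xi>) at_top at_top"
    and A4: "\<exists>\<xi>\<^sub>0 C\<^sub>1 C\<^sub>2. \<xi>\<^sub>0 \<ge> 1 \<and> C\<^sub>1 > 0 \<and> C\<^sub>2 > 0 \<and>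
               (\<forall>x\<in>\<Omega>. (\<forall>\<xi>\<ge>\<xi>\<^sub>0. C\<^sub>1 * \<xi> powr p \<le> \<psi> x \<xi>) \<and>
                        (\<forall>\<xi>\<ge>0. \<psi> x \<xi> \<le> C\<^sub>2 * (1 + \<xi> powr q)))"
    and A5: "\<exists>C\<^sub>4. \<forall>x\<in>\<Omega>. \<forall>\<xi>\<ge>0. \<psi> x (2 * \<xi>) \<le> C\<^sub>4 * \<psi> x \<xi>"
    and bounded_approx: "\<And>u. u \<in> W1psi_0 \<Omega> \<psi> \<inter> Linfty \<Omega> \<Longrightarrow>
               \<exists>U :: nat \<Rightarrow> 'a \<Rightarrow> real. (\<forall>n. U n \<in> Cc_infty \<Omega>) \<and>
                 (\<lambda>n. W1psi_norm \<Omega> \<psi> (\<lambda>x. U n x - u x)) \<longlonglongrightarrow> 0"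
  shows "dense_in_W1psi_0 \<Omega> \<psi> (Cc_infty \<Omega>) \<and>
    (\<forall>u\<^sub>0\<in>W1p \<Omega> q.
       (INF u\<in>translate u\<^sub>0 (W1p_0 \<Omega> p). energy \<Omega> \<psi> u) =
       (INF u\<in>translate u\<^sub>0 (W1p_0 \<Omega> q). energy \<Omega> \<psi> u) \<and>
       (INF u\<in>translate u\<^sub>0 (W1p_0 \<Omega> q). energy \<Omega> \<psi> u) =
       (INF u\<in>translate u\<^sub>0 (Cc_infty \<Omega>). energy \<Omega> \<psi> u))"
proof -
  have \<Omega>: "open \<Omega>" "bounded \<Omega>" using domain by (auto simp: bounded_lipschitz_domain_def)
  obtain C\<^sub>4 where C4: "\<And>x \<xi>. x \<in> \<Omega> \<Longrightarrow> 0 \<le> \<xi> \<Longrightarrow> \<psi> x (2 * \<xi>) \<le> C\<^sub>4 * \<psi> x \<xi>"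
    using A5 by blast
  obtain C\<^sub>2 where C2: "C\<^sub>2 > 0" "\<And>x \<xi>. x \<in> \<Omega> \<Longrightarrow> 0 \<le> \<xi> \<Longrightarrow> \<psi> x \<xi> \<le> C\<^sub>2 * (1 + \<xi> powr q)"
    using A4 by blast
  \<comment> \<open>Raising the doubling constant to at least 1 preserves the inequality because
    \<psi> is nonnegative.\<close>
  interpret doubling_young_function \<Omega> \<psi> "max 1 C\<^sub>4"
  proof
    show "\<psi> x (2 * \<xi>) \<le> max 1 C\<^sub>4 * \<psi> x \<xi>" if "x \<in> \<Omega>" "0 \<le> \<xi>" for x \<xi>
      using C4[OF that] mult_right_mono[of C\<^sub>4 "max 1 C\<^sub>4" "\<psi> x \<xi>"] psi_nonneg[OF that] by simp
  qed (use \<Omega> psi_nonneg psi_measurable A1 A2 in auto)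
  have "dense_in_W1psi_0 \<Omega> \<psi> (Cc_infty \<Omega>)"
    unfolding dense_in_W1psi_0_def
    using Cc_infty_subset_W1psi_0[OF C2(2,1)] exponents Cc_infty_approximation[OF bounded_approx] by simp
  moreover have
    "(INF u\<in>translate u\<^sub>0 (W1p_0 \<Omega> p). energy \<Omega> \<psi> u) = (INF u\<in>translate u\<^sub>0 (W1p_0 \<Omega> q). energy \<Omega> \<psi> u) \<and>
     (INF u\<in>translate u\<^sub>0 (W1p_0 \<Omega> q). energy \<Omega> \<psi> u) = (INF u\<in>translate u\<^sub>0 (Cc_infty \<Omega>). energy \<Omega> \<psi> u)"
    if u0: "u\<^sub>0 \<in> W1p \<Omega> q" for u\<^sub>0
  proof -
    let ?I = "\<lambda>W. INF u\<in>translate u\<^sub>0 W. energy \<Omega> \<psi> u"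
    note wg = W1p_weak_grad[OF \<Omega>(1) u0]
    have fin: "modular (weak_grad \<Omega> u\<^sub>0) < \<infinity>" by (rule modular_finite_of_growth[OF C2(2,1) wg(3)])
    \<comment> \<open>Test functions lie in the class of exponent q, and that class in the one of
      exponent p, which settles two inequalities; the third, from test functions back to exponent p,
      closes the cycle.\<close>
    have anti: "?I W' \<le> ?I W" if "W \<subseteq> W'" for W W'
      using that by (intro INF_superset_mono) (auto simp: translate_def)
    have "?I (W1p_0 \<Omega> p) \<le> ?I (W1p_0 \<Omega> q)"
      using exponents by (intro anti W1p_0_mono[OF \<Omega>]) auto
    moreover have "?I (W1p_0 \<Omega> q) \<le> ?I (Cc_infty \<Omega>)"
      using exponents by (intro anti Cc_infty_subset_W1p_0[OF \<Omega>]) auto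
    moreover have "?I (Cc_infty \<Omega>) \<le> ?I (W1p_0 \<Omega> p)"
    proof (rule INF_greatest)
      fix u assume "u \<in> translate u\<^sub>0 (W1p_0 \<Omega> p)"
      then obtain w where w: "w \<in> W1p_0 \<Omega> p" "u = (\<lambda>x. u\<^sub>0 x + w x)" by (auto simp: translate_def)
      \<comment> \<open>Exponent p > 1 is lowered to 1, the form in which
        \<open>infimum_le_energy\<close> accepts a competitor.\<close>
      have "w \<in> W1p_0 \<Omega> 1" using W1p_0_mono[OF \<Omega>, of 1 p] exponents w(1) by auto
      from infimum_le_energy[OF bounded_approx wg(2) fin this]
      show "?I (Cc_infty \<Omega>) \<le> energy \<Omega> \<psi> u" unfolding w(2) .
    qed
    ultimately show ?thesis by (meson order.antisym order.trans)
  qed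
  ultimately show ?thesis by blast
qed

end
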